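(* Let $\Omega$, $f$, $(\varphi,c)$ and $u$ be as in the context. Assume that $\nu_1(x)\ge 0$ for all $x\in\partial\Omega$, where $\nu_1(x)$ is the first component of the outward unit normal at $x$. Then there is complete invasion, that is, $u(t,\cdot)\to 1$ in $\Omega$ as $t\to+\infty$ (equivalently $u_\infty\equiv 1$ in $\Omega$). Moreover, if in addition $$\Omega\cap\{x\in\mathbb{R}^N:\ x_1>l\}=(l,+\infty)\times\omega_r$$ for some $l>0$ and some $\omega_r\subset\mathbb{R}^{N-1}$, then $c$ is the asymptotic speed of propagation, i.e. $$\forall\,\hat c>c,\quad \lim_{t\to+\infty}\ \sup_{x\in\Omega,\ x_1>\hat c t}u(t,x)=0,$$ $$\forall\,\hat c<c,\quad \lim_{t\to+\infty}\ \inf_{x\in\Omega,\ x_1<\hat c t}u(t,x)=1.$$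
   Context: Let $N\ge2$; points of $\mathbb{R}^N$ are written $x=(x_1,x')$ with $x_1\in\mathbb{R}$, $x'\in\mathbb{R}^{N-1}$. The outward unit normal of $\Omega$ is $\nu=(\nu_1,\nu')\in\mathbb{R}\times\mathbb{R}^{N-1}$. Domain: $\Omega\subset\mathbb{R}^N$ is an unbounded, uniformly $C^{2,\alpha}$ domain such that $\Omega\cap\{x_1<0\}=(-\infty,0)\times\omega$ for an open set $\omega\subset\mathbb{R}^{N-1}$. Nonlinearity: $f\in C^{1,1}([0,1])$ and there is $\theta\in(0,1)$ with $f(0)=f(\theta)=f(1)=0$, $f'(0)<0$, $f'(1)<0$, $f<0$ on $(0,\theta)$, $f>0$ on $(\theta,1)$; moreover $\int_0^1 f(s)\,ds>0$. Travelling front: $(\varphi,c)$, with $c>0$, is the unique solution of $\varphi''+c\varphi'+f(\varphi)=0$ in $\mathbb{R}$, $\varphi(-\infty)=1$, $\varphi(+\infty)=0$, $\varphi(0)=\theta$. Solution $u$: $u$ is the unique entire solution (defined for all $t\in\mathbb{R}$, with $0<u<1$) of $\partial_t u-\Delta u=f(u)$ in $\mathbb{R}\times\Omega$, $\partial_\nu u=0$ on $\mathbb{R}\times\partial\Omega$, such that $u(t,x)-\varphi(x_1-ct)\to0$ as $t\to-\infty$ uniformly in $\overline\Omega$. It is increasing in $t$, and $u_\infty:=\lim_{t\to+\infty}u(t,\cdot)$ (limit in $C^2_{loc}(\Omega)$) is a stationary solution. *)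

theory Defs
  imports "HOL-Analysis.Analysis"
begin

(* g and H are the gradient and the Hessian of v on the open set S, the Hessian being
   regarded as a bounded linear operator (the derivative of the gradient). *)
definition C2_on ::
  "'a::euclidean_space set \<Rightarrow> ('a \<Rightarrow> real) \<Rightarrow> ('a \<Rightarrow> 'a) \<Rightarrow> ('a \<Rightarrow> 'a \<Rightarrow>\<^sub>L 'a) \<Rightarrow> bool" where
  "C2_on S v g H \<longleftrightarrow>
     (\<forall>x\<in>S. GDERIV v x :> g x \<and> (g has_derivative blinfun_apply (H x)) (at x)) \<and>
     continuous_on S H"

definition C2_loc_tendsto ::
  "'a::euclidean_space set \<Rightarrow> ('i \<Rightarrow> 'a \<Rightarrow> real) \<Rightarrow> ('a \<Rightarrow> real) \<Rightarrow> 'i filter \<Rightarrow> bool" where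
  "C2_loc_tendsto S u v F \<longleftrightarrow>
     (\<exists>G H g h. (\<forall>t. C2_on S (u t) (G t) (H t)) \<and> C2_on S v g h \<and>
        (\<forall>K. compact K \<and> K \<subseteq> S \<longrightarrow>
           uniform_limit K u v F \<and> uniform_limit K G g F \<and> uniform_limit K H h F))"

definition C2_holder_bounded :: "real \<Rightarrow> real \<Rightarrow> ('a::euclidean_space \<Rightarrow> real) \<Rightarrow> bool" where
  "C2_holder_bounded \<alpha> K \<psi> \<longleftrightarrow>
     (\<exists>g H. C2_on UNIV \<psi> g H \<and>
        (\<forall>x. \<bar>\<psi> x\<bar> \<le> K \<and> norm (g x) \<le> K \<and> norm (H x) \<le> K) \<and>
        (\<forall>x y. norm (H x - H y) \<le> K * dist x y powr \<alpha>))"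

(* R^N is the product of R and R^(N-1), with its Euclidean norm; a point is x = (fst x, snd x).
   Near every boundary point y, after a rigid motion sending y to 0, the domain is the
   subgraph of a C^{2,alpha} function; the size r of the neighbourhood and the bound K on
   the C^{2,alpha} norm do not depend on y. *)
definition uniformly_C2_holder_domain ::
  "real \<Rightarrow> (real \<times> 'b::euclidean_space) set \<Rightarrow> bool" where
  "uniformly_C2_holder_domain \<alpha> \<Omega> \<longleftrightarrow>
     open \<Omega> \<and> connected \<Omega> \<and> \<Omega> \<noteq> {} \<and>
     (\<exists>r>0. \<exists>K. \<forall>y\<in>frontier \<Omega>. \<exists>T (\<psi> :: 'b \<Rightarrow> real).
        orthogonal_transformation T \<and> C2_holder_bounded \<alpha> K \<psi> \<and>
        (\<forall>x\<in>ball y r. x \<in> \<Omega> \<longleftrightarrow> fst (T (x - y)) < \<psi> (snd (T (x - y)))))"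

(* The outward unit normal is the normalised gradient of a C^1 function rho with nonvanishing
   gradient that defines the set as {rho < 0} near the boundary point x. *)
definition outward_unit_normal_at ::
  "'a::euclidean_space set \<Rightarrow> 'a \<Rightarrow> 'a \<Rightarrow> bool" where
  "outward_unit_normal_at \<Omega> x n \<longleftrightarrow>
     x \<in> frontier \<Omega> \<and>
     (\<exists>U \<rho> g. open U \<and> x \<in> U \<and>
        (\<forall>z\<in>U. GDERIV \<rho> z :> g z) \<and> continuous_on U g \<and>
        (\<forall>z\<in>U. z \<in> \<Omega> \<longleftrightarrow> \<rho> z < 0) \<and>
        g x \<noteq> 0 \<and> n = g x /\<^sub>R norm (g x))"

(* Derivatives on the closed interval [0,1] are one-sided at its endpoints. *)
definition bistable_nonlinearity :: "(real \<Rightarrow> real) \<Rightarrow> real \<Rightarrow> bool" where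
  "bistable_nonlinearity f \<theta> \<longleftrightarrow>
     0 < \<theta> \<and> \<theta> < 1 \<and>
     (\<exists>f'. (\<forall>s\<in>{0..1}. (f has_real_derivative f' s) (at s within {0..1})) \<and>
           (\<exists>L. L-lipschitz_on {0..1} f') \<and> f' 0 < 0 \<and> f' 1 < 0) \<and>
     f 0 = 0 \<and> f \<theta> = 0 \<and> f 1 = 0 \<and>
     (\<forall>s\<in>{0<..<\<theta>}. f s < 0) \<and> (\<forall>s\<in>{\<theta><..<1}. f s > 0) \<and>
     integral {0..1} f > 0"

(* The nonlinearity is only meaningful on [0,1] (its values elsewhere are arbitrary), so the
   profile is required to take its values there. *)
definition travelling_front ::
  "(real \<Rightarrow> real) \<Rightarrow> real \<Rightarrow> (real \<Rightarrow> real) \<Rightarrow> real \<Rightarrow> bool" where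
  "travelling_front f \<theta> \<phi> c \<longleftrightarrow>
     (\<forall>z. \<phi> z \<in> {0..1}) \<and>
     (\<exists>\<phi>' \<phi>''. \<forall>z. (\<phi> has_real_derivative \<phi>' z) (at z) \<and>
        (\<phi>' has_real_derivative \<phi>'' z) (at z) \<and>
        \<phi>'' z + c * \<phi>' z + f (\<phi> z) = 0) \<and>
     (\<phi> \<longlongrightarrow> 1) at_bot \<and> (\<phi> \<longlongrightarrow> 0) at_top \<and> \<phi> 0 = \<theta>"

(* Classical entire solutions: C^1 in time and C^2 in space inside, with a spatial gradient
   that is continuous up to the boundary. The Laplacian is the trace of the Hessian. *)
definition entire_neumann_solution ::
  "(real \<Rightarrow> real) \<Rightarrow> 'a::euclidean_space set \<Rightarrow> ('a \<Rightarrow> 'a) \<Rightarrow> (real \<Rightarrow> 'a \<Rightarrow> real) \<Rightarrow> bool" where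
  "entire_neumann_solution f \<Omega> \<nu> u \<longleftrightarrow>
     continuous_on (UNIV \<times> closure \<Omega>) (\<lambda>(t, x). u t x) \<and>
     (\<exists>ut G H.
        continuous_on (UNIV \<times> closure \<Omega>) (\<lambda>(t, x). G t x) \<and>
        continuous_on (UNIV \<times> \<Omega>) (\<lambda>(t, x). ut t x) \<and>
        continuous_on (UNIV \<times> \<Omega>) (\<lambda>(t, x). H t x) \<and>
        (\<forall>t. \<forall>x\<in>closure \<Omega>. (u t has_derivative (\<lambda>h. G t x \<bullet> h)) (at x within closure \<Omega>)) \<and>
        (\<forall>t. \<forall>x\<in>\<Omega>. ((\<lambda>s. u s x) has_real_derivative ut t x) (at t)) \<and>
        (\<forall>t. \<forall>x\<in>\<Omega>. (G t has_derivative blinfun_apply (H t x)) (at x)) \<and>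
        (\<forall>t. \<forall>x\<in>\<Omega>. ut t x - (\<Sum>b\<in>Basis. blinfun_apply (H t x) b \<bullet> b) = f (u t x)) \<and>
        (\<forall>t. \<forall>x\<in>frontier \<Omega>. G t x \<bullet> \<nu> x = 0))"

end

theory Submission
  imports Defs
begin

text \<open>
On the boundary, the planar wave \<open>\<phi> (x\<^sub>1 - s * t - d)\<close> has the normal derivative \<open>\<phi>' * \<nu>\<^sub>1\<close>. Since the front is
decreasing and \<open>\<nu>\<^sub>1 \<ge> 0\<close>, this derivative is nonpositive: planar waves are subsolutions of the
Neumann problem. In the distant past the solution is uniformly close to the front, so it stays above
the front at later times up to small errors, and the front invades the whole domain.

To absorb the errors, the wave is given a speed \<open>s\<close> slightly below \<open>c\<close> and is lowered by a small
constant \<open>q\<close> (\<open>planar_wave_comparison\<close>). Near the values 0 and 1 of the front a vertical shift is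
harmless because \<open>f\<close> decreases there; in between, the front is strictly decreasing, and the term
\<open>(c - s) * \<phi>'\<close> outweighs the effect of a small shift (\<open>travelling_front_profile\<close>). It follows that \<open>u\<close> is
eventually above \<open>1 - \<epsilon>\<close> on \<open>{x\<^sub>1 < c' * t}\<close> for every \<open>c' < c\<close> (\<open>invasion_from_left\<close>). Taking
\<open>0 < c' < c\<close> gives complete invasion, since a compact set is eventually contained in this half-space; an
arbitrary \<open>c' < c\<close> gives the lower bound on the speed.

The upper bound uses waves that are slightly too fast and raised by \<open>q\<close>. For these the boundary term
has the wrong sign in general, but inside the straight cylinder \<open>{x\<^sub>1 > l}\<close> it vanishes, and to the left of the
cylinder the raised wave can be kept above 1, where the comparison is trivial
(\<open>vanishing_ahead_of_front\<close>).

The analytic core is a comparison principle on an unbounded domain for classical solutions whose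
spatial gradient, but not the Hessian, extends to the boundary (\<open>neumann_comparison\<close>). Maxima need not
be attained, and the Neumann condition is not strict; both difficulties are removed by the local
barrier of \<open>boundary_barrier\<close>, a linear function along the axis of the graph representation of the boundary plus
a squared distance.
\<close>

section \<open>First- and second-order conditions along a line\<close>

lemma has_derivative_along_ray:
  fixes w :: "'a::real_normed_vector \<Rightarrow> real"
  assumes w: "(w has_derivative D) (at x within S)"
    and ray: "\<And>s. s \<in> I \<Longrightarrow> x + s *\<^sub>R d \<in> S"
  shows "((\<lambda>s. w (x + s *\<^sub>R d)) has_real_derivative D d) (at 0 within I)"
proof -
  have "(w has_derivative D) (at (x + 0 *\<^sub>R d) within (\<lambda>s. x + s *\<^sub>R d) ` I)"
    using ray by (auto intro!: has_derivative_subset[OF w])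
  moreover have "((\<lambda>s. x + s *\<^sub>R d) has_derivative (\<lambda>s. s *\<^sub>R d)) (at 0 within I)"
    by (auto intro!: derivative_eq_intros)
  ultimately have "((\<lambda>s. w (x + s *\<^sub>R d)) has_derivative (\<lambda>s. D (s *\<^sub>R d))) (at 0 within I)"
    by (rule has_derivative_in_compose[rotated])
  moreover have "D (s *\<^sub>R d) = D d * s" for s
    using linear_scale[OF has_derivative_linear[OF w]] by simp
  ultimately show ?thesis
    by (simp add: has_field_derivative_def)
qed

lemma directional_derivative_nonpos_at_max:
  fixes w :: "'a::real_normed_vector \<Rightarrow> real"
  assumes w: "(w has_derivative D) (at x within S)" and e: "0 < e"
    and ray: "\<And>s. 0 < s \<Longrightarrow> s < e \<Longrightarrow> x + s *\<^sub>R d \<in> S \<and> w (x + s *\<^sub>R d) \<le> w x"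
  shows "D d \<le> 0"
proof (rule ccontr)
  assume "\<not> D d \<le> 0"
  moreover have "((\<lambda>s. w (x + s *\<^sub>R d)) has_real_derivative D d) (at 0 within {0<..<e})"
    by (rule has_derivative_along_ray[OF w]) (use ray in auto)
  ultimately obtain r where r: "r > 0"
    "\<And>h. h > 0 \<Longrightarrow> 0 + h \<in> {0<..<e} \<Longrightarrow> h < r \<Longrightarrow> w (x + 0 *\<^sub>R d) < w (x + (0 + h) *\<^sub>R d)"
    using has_real_derivative_pos_inc_right by (metis not_le)
  define h where "h = min e r / 2"
  have "0 < h" "h < e" "h < r"
    using e r(1) by (auto simp: h_def min_def)
  then show False
    using r(2)[of h] ray[of h] by simp
qed

text \<open>Along the line in direction \<open>b\<close> the derivative of \<open>w\<close> vanishes at the maximum, so a positive second derivative would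
make it positive just after, and the mean value theorem would make \<open>w\<close> exceed its maximum.\<close>

lemma second_derivative_nonpos_at_max:
  fixes w :: "'a::real_inner \<Rightarrow> real"
  assumes U: "open U" "x \<in> U"
    and w: "\<And>y. y \<in> U \<Longrightarrow> (w has_derivative (\<lambda>h. g y \<bullet> h)) (at y)"
    and g: "(g has_derivative H) (at x)"
    and max: "\<And>y. y \<in> U \<Longrightarrow> w y \<le> w x"
  shows "H b \<bullet> b \<le> 0"
proof (rule ccontr)
  assume *: "\<not> H b \<bullet> b \<le> 0"
  obtain r where r: "r > 0" "ball x r \<subseteq> U"
    using U openE by blast
  define e where "e = r / (norm b + 1)"
  have e: "e > 0"
    using r by (auto simp: e_def add_nonneg_pos)
  have inU: "x + s *\<^sub>R b \<in> U" if "\<bar>s\<bar> < e" for s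
  proof -
    have "\<bar>s\<bar> * norm b \<le> \<bar>s\<bar> * (norm b + 1)"
      by (intro mult_left_mono) auto
    also have "\<dots> < r"
      using that by (simp add: e_def pos_less_divide_eq add_nonneg_pos)
    finally have "x + s *\<^sub>R b \<in> ball x r"
      by (simp add: dist_norm)
    then show ?thesis
      using r by auto
  qed
  have "g x \<bullet> b \<le> 0"
    by (rule directional_derivative_nonpos_at_max[OF has_derivative_at_withinI[OF w[OF U(2)], of U] e])
      (auto intro!: inU max)
  moreover have "g x \<bullet> (- b) \<le> 0"
    by (rule directional_derivative_nonpos_at_max[OF has_derivative_at_withinI[OF w[OF U(2)], of U] e])
      (use inU[of "- s" for s] in \<open>auto intro!: max\<close>)
  ultimately have g0: "g x \<bullet> b = 0"
    by simp
  have "((\<lambda>y. g y \<bullet> b) has_derivative (\<lambda>h. H h \<bullet> b)) (at x)"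
    by (rule has_derivative_inner_left[OF g])
  from has_derivative_along_ray[OF this, of UNIV b]
  have "((\<lambda>s. g (x + s *\<^sub>R b) \<bullet> b) has_real_derivative H b \<bullet> b) (at 0)"
    by simp
  from DERIV_pos_inc_right[OF this] *
  obtain d where d: "d > 0" "\<And>h. h > 0 \<Longrightarrow> h < d \<Longrightarrow> 0 < g (x + h *\<^sub>R b) \<bullet> b"
    using g0 by auto
  define s where "s = min d e / 2"
  have s: "0 < s" "s < d" "s < e"
    using d(1) e by (auto simp: s_def min_def)
  have der: "((\<lambda>s. w (x + s *\<^sub>R b)) has_real_derivative g (x + y *\<^sub>R b) \<bullet> b) (at y)"
    if y: "0 \<le> y" "y \<le> s" for y
  proof -
    have "((\<lambda>s. w ((x + y *\<^sub>R b) + s *\<^sub>R b)) has_real_derivative g (x + y *\<^sub>R b) \<bullet> b) (at 0)"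
      by (rule has_derivative_along_ray[OF w]) (use y s inU in auto)
    from DERIV_shift[where z = "- y" and x = y and f = "\<lambda>s. w ((x + y *\<^sub>R b) + s *\<^sub>R b)"] this
    show ?thesis
      by (simp add: algebra_simps)
  qed
  obtain z where "0 < z" "z < s" "w (x + s *\<^sub>R b) - w (x + 0 *\<^sub>R b) = (s - 0) * (g (x + z *\<^sub>R b) \<bullet> b)"
    using MVT2[OF s(1) der] by blast
  then have "w (x + s *\<^sub>R b) > w x"
    using mult_pos_pos[OF s(1) d(2)[of z]] s by simp
  then show False
    using max[OF inU[of s]] s by simp
qed

section \<open>Outward normals\<close>

text \<open>The defining function vanishes or is negative at a boundary point, because the domain accumulates
there, and it strictly decreases along every direction with a negative normal component.\<close>

lemma outward_normal_enters:
  assumes n: "outward_unit_normal_at \<Omega> x n" and d: "d \<bullet> n < 0"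
  obtains e where "e > 0" "\<And>s. 0 < s \<Longrightarrow> s < e \<Longrightarrow> x + s *\<^sub>R d \<in> \<Omega>"
proof -
  obtain U \<rho> g where fr: "x \<in> frontier \<Omega>" and U: "open U" "x \<in> U"
    and der: "\<And>z. z \<in> U \<Longrightarrow> GDERIV \<rho> z :> g z"
    and iff: "\<And>z. z \<in> U \<Longrightarrow> z \<in> \<Omega> \<longleftrightarrow> \<rho> z < 0"
    and g: "g x \<noteq> 0" "n = g x /\<^sub>R norm (g x)"
    using n unfolding outward_unit_normal_at_def by metis
  have \<rho>: "(\<rho> has_derivative (\<lambda>h. h \<bullet> g x)) (at x)"
    using der[OF U(2)] by (simp add: gderiv_def)
  have "d \<bullet> g x < 0"
    using d g by (simp add: inner_simps divide_simps mult_less_0_iff)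
  obtain r where r: "r > 0" "ball x r \<subseteq> U"
    using U openE by blast
  have le0: "\<rho> x \<le> 0"
  proof (rule ccontr)
    assume "\<not> \<rho> x \<le> 0"
    moreover have "isCont \<rho> x"
      using \<rho> has_derivative_continuous by blast
    ultimately have "eventually (\<lambda>z. \<rho> z > 0) (nhds x)"
      by (metis isCont_def order_tendstoD(1) tendsto_at_iff_tendsto_nhds not_le)
    moreover have "eventually (\<lambda>z. z \<in> U) (nhds x)"
      using U by (rule eventually_nhds_in_open)
    ultimately have "eventually (\<lambda>z. \<rho> z > 0 \<and> z \<in> U) (nhds x)"
      by eventually_elim auto
    then obtain V where V: "open V" "x \<in> V" "\<And>z. z \<in> V \<Longrightarrow> \<rho> z > 0 \<and> z \<in> U"
      by (auto simp: eventually_nhds)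
    then obtain z where "z \<in> V" "z \<in> \<Omega>"
      using fr open_Int_closure_eq_empty[of V \<Omega>] by (auto simp: frontier_def)
    then show False
      using V(3) iff by force
  qed
  obtain e where e: "e > 0" "\<And>h. h > 0 \<Longrightarrow> h < e \<Longrightarrow> \<rho> (x + h *\<^sub>R d) < \<rho> x"
    using has_real_derivative_neg_dec_right[OF has_derivative_along_ray[OF \<rho>, of UNIV d]]
      \<open>d \<bullet> g x < 0\<close> by auto
  define e' where "e' = min e (r / (norm d + 1))"
  have "e' > 0"
    using e r by (auto simp: e'_def add_nonneg_pos)
  moreover have "x + s *\<^sub>R d \<in> \<Omega>" if s: "0 < s" "s < e'" for s
  proof -
    have "s * norm d \<le> s * (norm d + 1)"
      using s by (intro mult_left_mono) auto
    also have "\<dots> < r"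
      using s by (simp add: e'_def pos_less_divide_eq add_nonneg_pos)
    finally have "x + s *\<^sub>R d \<in> ball x r"
      using s by (simp add: dist_norm)
    then have "x + s *\<^sub>R d \<in> U"
      using r by auto
    moreover have "\<rho> (x + s *\<^sub>R d) < 0"
      using e(2)[of s] s le0 by (simp add: e'_def)
    ultimately show ?thesis
      using iff by auto
  qed
  ultimately show ?thesis
    using that by blast
qed

lemma outward_normal_nonzero: "outward_unit_normal_at \<Omega> x n \<Longrightarrow> n \<noteq> 0"
  by (auto simp: outward_unit_normal_at_def)

text \<open>A function that is maximal over the domain at a boundary point cannot increase along any
direction pointing into the domain, so its gradient lies in the polar cone of an open half-space,
which is the ray spanned by the normal. Applied to a second defining function of the domain, this
shows that the outward normal does not depend on the choice of the defining function; it is how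
the normal of \<^const>\<open>outward_unit_normal_at\<close> is matched with the graph representation of the
boundary.\<close>

lemma gradient_parallel_outward_normal:
  assumes n: "outward_unit_normal_at \<Omega> x n"
    and \<sigma>: "(\<sigma> has_derivative (\<lambda>h. m \<bullet> h)) (at x)"
    and V: "open V" "x \<in> V"
    and max: "\<And>z. z \<in> V \<Longrightarrow> z \<in> \<Omega> \<Longrightarrow> \<sigma> z \<le> \<sigma> x"
  obtains \<mu> where "\<mu> \<ge> 0" "m = \<mu> *\<^sub>R n"
proof -
  have n0: "n \<bullet> n > 0"
    using outward_normal_nonzero[OF n] by simp
  have dir: "m \<bullet> d \<le> 0" if d: "d \<bullet> n < 0" for d
  proof -
    obtain e where e: "e > 0" "\<And>s. 0 < s \<Longrightarrow> s < e \<Longrightarrow> x + s *\<^sub>R d \<in> \<Omega>"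
      using outward_normal_enters[OF n d] by blast
    obtain r where r: "r > 0" "ball x r \<subseteq> V"
      using V openE by blast
    define e' where "e' = min e (r / (norm d + 1))"
    have e': "e' > 0"
      using e r by (auto simp: e'_def add_nonneg_pos)
    show ?thesis
    proof (rule directional_derivative_nonpos_at_max[OF \<sigma> e'])
      fix s assume s: "0 < s" "s < e'"
      have "s * norm d \<le> s * (norm d + 1)"
        using s by (intro mult_left_mono) auto
      also have "\<dots> < r"
        using s by (simp add: e'_def pos_less_divide_eq add_nonneg_pos)
      finally have "x + s *\<^sub>R d \<in> ball x r"
        using s by (simp add: dist_norm)
      then show "x + s *\<^sub>R d \<in> UNIV \<and> \<sigma> (x + s *\<^sub>R d) \<le> \<sigma> x"
        using r s e(2)[of s] by (auto intro!: max simp: e'_def)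
    qed
  qed
  define p where "p = m - ((m \<bullet> n) / (n \<bullet> n)) *\<^sub>R n"
  have pn: "p \<bullet> n = 0"
    using n0 by (simp add: p_def inner_simps)
  have mp: "m \<bullet> p = p \<bullet> p"
    using pn by (simp add: p_def inner_simps inner_commute)
  \<comment> \<open>The part of the gradient orthogonal to the normal is an admissible direction as
    soon as it is tilted inwards by an arbitrarily small amount.\<close>
  have "p \<bullet> p \<le> \<eta> * (m \<bullet> n)" if "\<eta> > 0" for \<eta>
    using dir[of "p - \<eta> *\<^sub>R n"] that n0 pn mp by (simp add: inner_simps)
  moreover have nonneg: "m \<bullet> n \<ge> 0"
    using dir[of "- n"] n0 by simp
  ultimately have "p \<bullet> p \<le> 0"
  proof -
    assume a: "\<And>\<eta>. \<eta> > 0 \<Longrightarrow> p \<bullet> p \<le> \<eta> * (m \<bullet> n)"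
    show ?thesis
    proof (rule field_le_epsilon)
      fix \<epsilon> :: real assume "\<epsilon> > 0"
      moreover have "\<epsilon> / (m \<bullet> n + 1) * (m \<bullet> n) \<le> \<epsilon>"
        using \<open>\<epsilon> > 0\<close> nonneg by (simp add: divide_simps)
      ultimately show "p \<bullet> p \<le> 0 + \<epsilon>"
        using a[of "\<epsilon> / (m \<bullet> n + 1)"] nonneg by simp
    qed
  qed
  then have "p = 0"
    by (metis inner_eq_zero_iff inner_ge_zero order_antisym)
  then have "m = ((m \<bullet> n) / (n \<bullet> n)) *\<^sub>R n"
    by (simp add: p_def)
  then show ?thesis
    using that nonneg n0 by (metis divide_nonneg_pos)
qed

section \<open>A uniform local barrier at the boundary\<close>

lemma C2_remainder_bound:
  assumes "C2_holder_bounded \<alpha> K \<psi>"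
  obtains g where "\<And>x. (\<psi> has_derivative (\<lambda>h. g x \<bullet> h)) (at x)"
    "\<And>x y. \<psi> y - \<psi> x - g x \<bullet> (y - x) \<le> K * (norm (y - x))\<^sup>2"
proof -
  obtain g H where C2: "C2_on UNIV \<psi> g H" and K: "\<And>x. norm (H x) \<le> K"
    using assms by (auto simp: C2_holder_bounded_def)
  have dpsi: "(\<psi> has_derivative (\<lambda>h. g x \<bullet> h)) (at x)" for x
    using C2 by (simp add: C2_on_def gderiv_def inner_commute)
  have dg: "(g has_derivative blinfun_apply (H x)) (at x)" for x
    using C2 by (simp add: C2_on_def)
  have lip: "norm (g y - g x) \<le> K * norm (y - x)" for x y
    by (rule differentiable_bound[where S = UNIV and f' = "\<lambda>z. blinfun_apply (H z)"])
      (use dg K in \<open>auto simp: norm_blinfun.rep_eq[symmetric]\<close>)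
  have "\<psi> y - \<psi> x - g x \<bullet> (y - x) \<le> K * (norm (y - x))\<^sup>2" for x y
  proof -
    have "((\<lambda>s. \<psi> (x + s *\<^sub>R (y - x))) has_real_derivative g (x + t *\<^sub>R (y - x)) \<bullet> (y - x)) (at t)" for t
    proof -
      have "((\<lambda>s. \<psi> ((x + t *\<^sub>R (y - x)) + s *\<^sub>R (y - x))) has_real_derivative g (x + t *\<^sub>R (y - x)) \<bullet> (y - x)) (at 0)"
        by (rule has_derivative_along_ray[OF dpsi]) auto
      from DERIV_shift[where z = "- t" and x = t and f = "\<lambda>s. \<psi> ((x + t *\<^sub>R (y - x)) + s *\<^sub>R (y - x))"] this
      show ?thesis
        by (simp add: algebra_simps)
    qed
    then obtain t :: real where t: "0 < t" "t < 1"
      "\<psi> (x + 1 *\<^sub>R (y - x)) - \<psi> (x + 0 *\<^sub>R (y - x)) = (1 - 0) * (g (x + t *\<^sub>R (y - x)) \<bullet> (y - x))"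
      using MVT2[of 0 1 "\<lambda>s. \<psi> (x + s *\<^sub>R (y - x))" "\<lambda>t. g (x + t *\<^sub>R (y - x)) \<bullet> (y - x)"] by auto
    have "\<psi> y - \<psi> x - g x \<bullet> (y - x) = (g (x + t *\<^sub>R (y - x)) - g x) \<bullet> (y - x)"
      using t(3) by (simp add: inner_simps)
    also have "\<dots> \<le> norm (g (x + t *\<^sub>R (y - x)) - g x) * norm (y - x)"
      by (rule norm_cauchy_schwarz)
    also have "\<dots> \<le> K * norm (t *\<^sub>R (y - x)) * norm (y - x)"
      using lip[of "x + t *\<^sub>R (y - x)" x] by (intro mult_right_mono) auto
    also have "\<dots> = t * (K * (norm (y - x))\<^sup>2)"
      using t by (simp add: power2_eq_square)
    also have "\<dots> \<le> 1 * (K * (norm (y - x))\<^sup>2)"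
      using t order_trans[OF norm_ge_zero K[of x]] by (intro mult_right_mono) auto
    finally show ?thesis
      by simp
  qed
  then show ?thesis
    using that dpsi by blast
qed

text \<open>For a centre \<open>p\<close> in the closure, the vector in the conclusion is the gradient of
\<open>Q x = (R / 2) * (e \<bullet> (x - p)) + (x - p) \<bullet> (x - p)\<close>. This function increases strictly in the
outward normal direction at every boundary point near \<open>p\<close>; it vanishes at \<open>p\<close> and, since
\<open>norm e \<le> 1\<close>, it is at least \<open>R\<^sup>2 / 2\<close> on the sphere of radius \<open>R\<close> around \<open>p\<close>. Subtracting a small
multiple of it thus localises an approximate maximum and at the same time makes the Neumann
condition strict.

The vector \<open>e\<close> is the axis of the graph representation of the boundary, in which an outward
normal is \<open>(1, - \<nabla>\<psi>)\<close>; its inner product with \<open>e\<close> is 1. Because \<open>p\<close> lies below the graph, Taylor's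
formula bounds the contribution of \<open>x - p\<close> from below by \<open>- K * R\<^sup>2\<close>, which is dominated by the
linear part \<open>R / 2\<close> once \<open>R\<close> is small compared with \<open>1 / K\<close>. The uniformity of the domain makes \<open>R\<close>
independent of \<open>p\<close>.\<close>

lemma boundary_barrier:
  fixes \<Omega> :: "(real \<times> 'b::euclidean_space) set"
  assumes dom: "uniformly_C2_holder_domain \<alpha> \<Omega>"
  obtains R where "R > 0"
    "\<And>p. p \<in> closure \<Omega> \<Longrightarrow> \<exists>e. norm e \<le> 1 \<and>
       (\<forall>x\<in>frontier \<Omega> \<inter> cball p R. \<forall>n. outward_unit_normal_at \<Omega> x n \<longrightarrow>
          0 < ((R / 2) *\<^sub>R e + 2 *\<^sub>R (x - p)) \<bullet> n)"
proof -
  obtain r K where op: "open \<Omega>" and r: "r > 0"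
    and chart: "\<And>y. y \<in> frontier \<Omega> \<Longrightarrow> \<exists>T (\<psi> :: 'b \<Rightarrow> real).
        orthogonal_transformation T \<and> C2_holder_bounded \<alpha> K \<psi> \<and>
        (\<forall>x\<in>ball y r. x \<in> \<Omega> \<longleftrightarrow> fst (T (x - y)) < \<psi> (snd (T (x - y))))"
    using dom unfolding uniformly_C2_holder_domain_def by metis
  define R where "R = min (r / 4) (1 / (8 * (\<bar>K\<bar> + 1)))"
  have R: "R > 0" "2 * R < r" "4 * \<bar>K\<bar> * R < 1"
  proof -
    show "R > 0" "2 * R < r"
      using r by (auto simp: R_def)
    have "4 * \<bar>K\<bar> * R \<le> 4 * \<bar>K\<bar> * (1 / (8 * (\<bar>K\<bar> + 1)))"
      by (intro mult_left_mono) (auto simp: R_def)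
    also have "\<dots> < 1"
      by (simp add: divide_simps)
    finally show "4 * \<bar>K\<bar> * R < 1" .
  qed
  have "\<exists>e. norm e \<le> 1 \<and>
       (\<forall>x\<in>frontier \<Omega> \<inter> cball p R. \<forall>n. outward_unit_normal_at \<Omega> x n \<longrightarrow>
          0 < ((R / 2) *\<^sub>R e + 2 *\<^sub>R (x - p)) \<bullet> n)" if p: "p \<in> closure \<Omega>" for p
  proof (cases "frontier \<Omega> \<inter> cball p R = {}")
    case True
    then show ?thesis
      by (intro exI[of _ 0]) auto
  next
    case False
    then obtain y where y: "y \<in> frontier \<Omega>" "dist p y \<le> R"
      by auto
    obtain T and \<psi> :: "'b \<Rightarrow> real" where T: "orthogonal_transformation T"
      and \<psi>: "C2_holder_bounded \<alpha> K \<psi>"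
      and iff: "\<And>x. x \<in> ball y r \<Longrightarrow> x \<in> \<Omega> \<longleftrightarrow> fst (T (x - y)) < \<psi> (snd (T (x - y)))"
      using chart[OF y(1)] by metis
    have lin: "linear T"
      using T by (rule orthogonal_transformation_linear)
    have iso: "T a \<bullet> T b = a \<bullet> b" for a b
      using T unfolding orthogonal_transformation_def by blast
    have surj: "surj T"
      by (rule linear_injective_imp_surjective[OF lin orthogonal_transformation_inj[OF T]]) simp
    obtain g where g: "\<And>x. (\<psi> has_derivative (\<lambda>h. g x \<bullet> h)) (at x)"
      and taylor: "\<And>x y. \<psi> y - \<psi> x - g x \<bullet> (y - x) \<le> K * (norm (y - x))\<^sup>2"
      using C2_remainder_bound[OF \<psi>] by blast
    define \<sigma> where "\<sigma> z = fst (T (z - y)) - \<psi> (snd (T (z - y)))" for z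
    obtain e where e: "T e = (1, 0)"
      using surj by (metis surjD)
    have norm_e: "norm e = 1"
      using iso[of e e] e by (simp add: norm_eq_sqrt_inner)
    have Tder: "((\<lambda>z. T (z - y)) has_derivative T) (at x)" for x
      by (rule bounded_linear.has_derivative[OF linear_conv_bounded_linear[THEN iffD1, OF lin]])
        (auto intro!: derivative_eq_intros)
    have \<sigma>_der: "(\<sigma> has_derivative (\<lambda>h. fst (T h) - g (snd (T (x - y))) \<bullet> snd (T h))) (at x)" for x
    proof -
      have "((\<lambda>z. \<psi> (snd (T (z - y)))) has_derivative (\<lambda>h. g (snd (T (x - y))) \<bullet> snd (T h))) (at x)"
        by (rule has_derivative_compose[OF has_derivative_snd[OF Tder] g])
      then show ?thesis
        unfolding \<sigma>_def by (intro has_derivative_diff has_derivative_fst Tder)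
    qed
    have \<sigma>_cont: "continuous_on UNIV \<sigma>"
      by (rule has_derivative_continuous_on[OF \<sigma>_der])
    have \<sigma>p: "\<sigma> p \<le> 0"
    proof -
      have "p \<in> ball y r"
        using y R by (auto simp: dist_commute)
      then have "p \<in> closure (ball y r \<inter> \<Omega>)"
        using p open_Int_closure_subset[of "ball y r" \<Omega>] by auto
      also have "\<dots> \<subseteq> {z. \<sigma> z \<le> 0}"
        by (intro closure_minimal closed_Collect_le \<sigma>_cont continuous_on_const)
          (use iff in \<open>auto simp: \<sigma>_def less_imp_le\<close>)
      finally show ?thesis
        by simp
    qed
    have "0 < ((R / 2) *\<^sub>R e + 2 *\<^sub>R (x - p)) \<bullet> n"
      if x: "x \<in> frontier \<Omega>" "dist p x \<le> R" and n: "outward_unit_normal_at \<Omega> x n" for x n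
    proof -
      have xb: "x \<in> ball y r"
        using y x R dist_triangle[of y x p] by (auto simp: dist_commute)
      have \<sigma>x: "\<sigma> x \<ge> 0"
        using x op iff[OF xb] by (auto simp: \<sigma>_def frontier_def interior_open)
      define X P where "X = T (x - y)" and "P = T (p - y)"
      define G where "G = g (snd X)"
      \<comment> \<open>The gradient of \<open>\<sigma>\<close> at \<open>x\<close>.\<close>
      obtain m where m: "T m = (1, - G)"
        using surj by (metis surjD)
      have m_inner: "m \<bullet> h = fst (T h) - G \<bullet> snd (T h)" for h
        using iso[of m h] m by (simp add: inner_prod_def)
      have "(\<sigma> has_derivative (\<lambda>h. m \<bullet> h)) (at x)"
        using \<sigma>_der[of x] by (simp add: m_inner G_def X_def)
      moreover have "\<sigma> z \<le> \<sigma> x" if "z \<in> ball y r" "z \<in> \<Omega>" for z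
        using iff[OF that(1)] that(2) \<sigma>x by (simp add: \<sigma>_def)
      ultimately obtain \<mu> where \<mu>: "\<mu> \<ge> 0" "m = \<mu> *\<^sub>R n"
        using gradient_parallel_outward_normal[OF n _ open_ball xb] by blast
      have TXP: "T (x - p) = X - P"
        using linear_diff[OF lin, of "x - y" "p - y"] by (simp add: X_def P_def)
      have "norm (snd (P - X)) \<le> norm (P - X)"
        by (metis norm_snd_le prod.collapse)
      also have "\<dots> = norm (T (x - p))"
        by (simp add: TXP norm_minus_commute)
      also have "\<dots> = norm (x - p)"
        by (simp add: norm_eq_sqrt_inner iso)
      also have "\<dots> \<le> R"
        using x by (simp add: dist_norm norm_minus_commute)
      finally have "(norm (snd P - snd X))\<^sup>2 \<le> R\<^sup>2"
        by (simp add: power_mono)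
      then have "K * (norm (snd P - snd X))\<^sup>2 \<le> \<bar>K\<bar> * R\<^sup>2"
        by (intro mult_mono) auto
      moreover have "\<psi> (snd P) - \<psi> (snd X) - G \<bullet> (snd P - snd X) \<le> K * (norm (snd P - snd X))\<^sup>2"
        unfolding G_def by (rule taylor)
      moreover have "m \<bullet> (x - p) = fst X - fst P - G \<bullet> (snd X - snd P)"
        by (simp add: m_inner TXP)
      ultimately have "m \<bullet> (x - p) \<ge> - (\<bar>K\<bar> * R\<^sup>2)"
        using \<sigma>p \<sigma>x by (simp add: \<sigma>_def X_def[symmetric] P_def[symmetric] inner_diff_right)
      moreover have "m \<bullet> e = 1"
        by (simp add: m_inner e)
      moreover have "2 * (\<bar>K\<bar> * R\<^sup>2) < R / 2"
        using R mult_strict_right_mono[of "4 * \<bar>K\<bar> * R" 1 R] by (simp add: power2_eq_square)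
      ultimately have "0 < ((R / 2) *\<^sub>R e + 2 *\<^sub>R (x - p)) \<bullet> m"
        by (simp add: inner_add_right inner_commute[of _ m])
      then have "0 < \<mu> * (((R / 2) *\<^sub>R e + 2 *\<^sub>R (x - p)) \<bullet> n)"
        by (simp add: \<mu>(2))
      then show ?thesis
        using \<mu>(1) by (simp add: zero_less_mult_iff)
    qed
    then show ?thesis
      using norm_e by (intro exI[of _ e]) auto
  qed
  then show ?thesis
    using that R(1) by blast
qed

section \<open>A comparison principle with Neumann boundary conditions\<close>

text \<open>A bounded subsolution that is nonpositive initially stays nonpositive, on an unbounded domain
whose parabolic inequality and boundary inequality are known only where \<open>v\<close> is positive. Suppose that
\<open>W = exp (- \<kappa> * (t - T)) * v\<close>, with \<open>\<kappa>\<close> larger than \<open>L\<close>, has a positive supremum \<open>M\<close>. The supremum need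
not be attained, so a small multiple \<open>a\<close> of the barrier around a point \<open>p\<close> where \<open>W\<close> is close to \<open>M\<close> is
subtracted; the difference has a maximum over a compact cylinder, and this maximum is
neither on the sphere around \<open>p\<close> nor at the initial time. It is not on the boundary of the domain,
because there the normal derivative is strictly negative, so the difference grows inwards. At an
interior maximum the derivative tests give \<open>W \<le> 2 * a * N\<close>, where \<open>2 * N\<close> is the Laplacian of the
barrier, and this is impossible for small \<open>a\<close>.\<close>

theorem neumann_comparison:
  fixes \<Omega> :: "(real \<times> 'b::euclidean_space) set"
    and v vt :: "real \<Rightarrow> real \<times> 'b \<Rightarrow> real"
  assumes dom: "uniformly_C2_holder_domain \<alpha> \<Omega>"
    and normal: "\<forall>x\<in>frontier \<Omega>. outward_unit_normal_at \<Omega> x (\<nu> x)"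
    and cont: "continuous_on ({T..} \<times> closure \<Omega>) (\<lambda>(t, x). v t x)"
    and bound: "\<And>t x. T \<le> t \<Longrightarrow> x \<in> closure \<Omega> \<Longrightarrow> v t x \<le> B"
    and init: "\<And>x. x \<in> closure \<Omega> \<Longrightarrow> v T x \<le> 0"
    and grad: "\<And>t x. T < t \<Longrightarrow> x \<in> closure \<Omega> \<Longrightarrow>
      (v t has_derivative (\<lambda>h. G t x \<bullet> h)) (at x within closure \<Omega>)"
    and time: "\<And>t x. T < t \<Longrightarrow> x \<in> \<Omega> \<Longrightarrow> ((\<lambda>s. v s x) has_real_derivative vt t x) (at t)"
    and hess: "\<And>t x. T < t \<Longrightarrow> x \<in> \<Omega> \<Longrightarrow> (G t has_derivative H t x) (at x)"
    and ineq: "\<And>t x. T < t \<Longrightarrow> x \<in> \<Omega> \<Longrightarrow> 0 < v t x \<Longrightarrow>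
      vt t x - (\<Sum>b\<in>Basis. H t x b \<bullet> b) \<le> L * v t x"
    and bdry: "\<And>t x. T < t \<Longrightarrow> x \<in> frontier \<Omega> \<Longrightarrow> 0 < v t x \<Longrightarrow> G t x \<bullet> \<nu> x \<le> 0"
    and t: "T \<le> t" and x: "x \<in> closure \<Omega>"
  shows "v t x \<le> 0"
proof (rule ccontr)
  assume "\<not> v t x \<le> 0"
  then have vpos: "v t x > 0" by simp
  have op: "open \<Omega>"
    using dom by (simp add: uniformly_C2_holder_domain_def)
  have clo: "closure \<Omega> = \<Omega> \<union> frontier \<Omega>"
    using op closure_Un_frontier by blast
  obtain R where R: "R > 0"
    and barrier: "\<And>p. p \<in> closure \<Omega> \<Longrightarrow> \<exists>e. norm e \<le> 1 \<and>
       (\<forall>x\<in>frontier \<Omega> \<inter> cball p R. \<forall>n. outward_unit_normal_at \<Omega> x n \<longrightarrow>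
          0 < ((R / 2) *\<^sub>R e + 2 *\<^sub>R (x - p)) \<bullet> n)"
    using boundary_barrier[OF dom] by metis
  define \<kappa> where "\<kappa> = \<bar>L\<bar> + 1"
  define m where "m s = exp (- \<kappa> * (s - T))" for s
  have m_pos: "m s > 0" for s
    by (simp add: m_def)
  have m_le: "m s \<le> 1" if "T \<le> s" for s
    using that by (auto simp: m_def \<kappa>_def intro!: mult_nonpos_nonneg)
  define W where "W = (\<lambda>(s, z). m s * v s z)"
  define D where "D = {T..t} \<times> closure \<Omega>"
  define M where "M = (SUP q\<in>D. W q)"
  have W_le: "W q \<le> \<bar>B\<bar>" if "q \<in> D" for q
  proof -
    define s z where "s = fst q" and "z = snd q"
    have q: "q = (s, z)" "T \<le> s" "z \<in> closure \<Omega>"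
      using that by (auto simp: D_def s_def z_def)
    have "m s * v s z \<le> m s * \<bar>B\<bar>"
      using bound[OF q(2,3)] m_pos[of s] by (intro mult_left_mono) auto
    also have "\<dots> \<le> 1 * \<bar>B\<bar>"
      using m_le[OF q(2)] by (intro mult_right_mono) auto
    finally show ?thesis
      by (simp add: W_def q)
  qed
  have bdd: "bdd_above (W ` D)"
    using W_le by (auto intro!: bdd_aboveI[of _ "\<bar>B\<bar>"])
  have txD: "(t, x) \<in> D"
    using t x by (simp add: D_def)
  have W_le_M: "W q \<le> M" if "q \<in> D" for q
    unfolding M_def using that bdd by (rule cSUP_upper)
  have M: "M > 0"
    using W_le_M[OF txD] mult_pos_pos[OF m_pos[of t] vpos] by (simp add: W_def)
  define N where "N = real (card (Basis :: (real \<times> 'b) set))"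
  have N: "N > 0"
    by (simp add: N_def card_gt_0_iff)
  define a where "a = min (M / R\<^sup>2) (M / (8 * N))"
  have a: "a > 0" "a * R\<^sup>2 \<le> M" "2 * a * N < M / 2"
  proof -
    show "a > 0"
      using M R N by (simp add: a_def)
    have "a * R\<^sup>2 \<le> M / R\<^sup>2 * R\<^sup>2"
      by (intro mult_right_mono) (auto simp: a_def)
    then show "a * R\<^sup>2 \<le> M"
      using R by simp
    have "2 * a * N \<le> 2 * (M / (8 * N)) * N"
      using N by (intro mult_right_mono mult_left_mono) (auto simp: a_def)
    then show "2 * a * N < M / 2"
      using N M by simp
  qed
  have "\<exists>q\<in>D. M - a * R\<^sup>2 / 4 < W q"
    unfolding M_def using less_cSUP_iff[OF _ bdd, of "M - a * R\<^sup>2 / 4"] txD a(1) R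
    by (auto simp: M_def)
  then obtain tk p where tk: "tk \<in> {T..t}" and p: "p \<in> closure \<Omega>" and Wp: "M - a * R\<^sup>2 / 4 < W (tk, p)"
    by (auto simp: D_def)
  obtain e where e: "norm e \<le> 1"
    and eb: "\<And>x n. x \<in> frontier \<Omega> \<Longrightarrow> x \<in> cball p R \<Longrightarrow> outward_unit_normal_at \<Omega> x n \<Longrightarrow>
          0 < ((R / 2) *\<^sub>R e + 2 *\<^sub>R (x - p)) \<bullet> n"
    using barrier[OF p] by blast
  define Q where "Q z = (R / 2) * (e \<bullet> (z - p)) + (z - p) \<bullet> (z - p)" for z
  define q where "q z = (R / 2) *\<^sub>R e + 2 *\<^sub>R (z - p)" for z
  have Q_der: "(Q has_derivative (\<lambda>h. q z \<bullet> h)) (at z within S)" for z S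
    unfolding Q_def q_def
    by (auto intro!: derivative_eq_intros simp: fun_eq_iff inner_simps inner_commute)
  have q_der: "(q has_derivative (\<lambda>h. 2 *\<^sub>R h)) (at z within S)" for z S
    unfolding q_def by (auto intro!: derivative_eq_intros)
  have Q_lower: "Q z \<ge> (norm (z - p))\<^sup>2 - R / 2 * norm (z - p)" for z
  proof -
    have "\<bar>e \<bullet> (z - p)\<bar> \<le> norm e * norm (z - p)"
      by (rule Cauchy_Schwarz_ineq2)
    also have "\<dots> \<le> 1 * norm (z - p)"
      using e by (intro mult_right_mono) auto
    finally have "R / 2 * (- norm (z - p)) \<le> R / 2 * (e \<bullet> (z - p))"
      using R by (intro mult_left_mono) auto
    then show ?thesis
      by (simp add: Q_def power2_norm_eq_inner)
  qed
  \<comment> \<open>Completing the square in the lower bound.\<close>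
  have Q_min: "Q z \<ge> - (R\<^sup>2 / 16)" for z
  proof -
    have "0 \<le> (norm (z - p) - R / 4)\<^sup>2"
      by simp
    then show ?thesis
      using Q_lower[of z] by (simp add: power2_eq_square algebra_simps)
  qed
  define C where "C = {T..t} \<times> (closure \<Omega> \<inter> cball p R)"
  have CD: "C \<subseteq> D"
    by (auto simp: C_def D_def)
  define w where "w = (\<lambda>(s, z). m s * v s z - a * Q z)"
  have "compact C"
    unfolding C_def by (intro compact_Times closed_Int_compact) auto
  moreover have "C \<noteq> {}"
    using tk p R by (auto simp: C_def)
  moreover have "continuous_on C w"
  proof -
    have 1: "continuous_on C (\<lambda>(s, z). v s z)"
      by (rule continuous_on_subset[OF cont]) (auto simp: C_def)
    have "continuous_on C (\<lambda>q. m (fst q) * (\<lambda>(s, z). v s z) q - a * Q (snd q))"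
      unfolding m_def Q_def by (intro continuous_intros 1)
    then show ?thesis
      by (simp add: w_def case_prod_beta')
  qed
  ultimately obtain q0 where q0: "q0 \<in> C" "\<And>q. q \<in> C \<Longrightarrow> w q \<le> w q0"
    using continuous_attains_sup[of C w] by blast
  obtain t0 x0 where q0_eq: "q0 = (t0, x0)"
    by (cases q0)
  have t0: "T \<le> t0" "t0 \<le> t" and x0: "x0 \<in> closure \<Omega>" "x0 \<in> cball p R"
    using q0(1) by (auto simp: C_def q0_eq)
  have wmax: "m s * v s z - a * Q z \<le> m t0 * v t0 x0 - a * Q x0"
    if "T \<le> s" "s \<le> t" "z \<in> closure \<Omega>" "z \<in> cball p R" for s z
    using q0(2)[of "(s, z)"] that by (auto simp: C_def w_def q0_eq)
  have Qp: "Q p = 0"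
    by (simp add: Q_def)
  have w0: "M - a * R\<^sup>2 / 4 < m t0 * v t0 x0 - a * Q x0"
    using wmax[of tk p] tk p R Wp Qp by (auto simp: W_def)
  have W0: "m t0 * v t0 x0 \<le> M"
    using W_le_M[of "(t0, x0)"] q0(1) CD by (auto simp: W_def q0_eq)
  have "a * - (R\<^sup>2 / 16) \<le> a * Q x0"
    using a Q_min by (intro mult_left_mono) auto
  then have W_half: "M / 2 < m t0 * v t0 x0"
    using w0 a(2) M by simp
  then have "m t0 * v t0 x0 > 0"
    using M by simp
  then have v0: "v t0 x0 > 0"
    using m_pos[of t0] by (simp add: zero_less_mult_iff)
  then have Tt0: "T < t0"
    using init[OF x0(1)] t0(1) by (cases "t0 = T") auto
  have "norm (x0 - p) < R"
  proof (rule ccontr)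
    assume "\<not> norm (x0 - p) < R"
    then have "norm (x0 - p) = R"
      using x0(2) by (simp add: dist_norm norm_minus_commute)
    then have "R\<^sup>2 / 2 \<le> Q x0"
      using Q_lower[of x0] by (simp add: power2_eq_square)
    then have "a * (R\<^sup>2 / 2) \<le> a * Q x0"
      using a by (intro mult_left_mono) auto
    moreover have "a * R\<^sup>2 > 0"
      using a R by simp
    ultimately show False
      using w0 W0 by simp
  qed
  then have x0b: "x0 \<in> ball p R"
    by (simp add: dist_norm norm_minus_commute)
  then obtain r where r: "r > 0" "ball x0 r \<subseteq> ball p R"
    using open_ball openE by blast
  have w_der: "((\<lambda>z. m t0 * v t0 z - a * Q z) has_derivative (\<lambda>h. (m t0 *\<^sub>R G t0 z - a *\<^sub>R q z) \<bullet> h)) (at z within closure \<Omega>)"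
    if "z \<in> closure \<Omega>" for z
    using grad[OF Tt0 that] Q_der[of z "closure \<Omega>"]
    by (auto intro!: derivative_eq_intros simp: inner_simps)
  show False
  proof (cases "x0 \<in> \<Omega>")
    case True
    have intr: "at z within closure \<Omega> = at z" if "z \<in> \<Omega>" for z
      using that op by (metis at_within_interior closure_subset interior_maximal subsetD)
    define U where "U = \<Omega> \<inter> ball x0 r"
    have second_der: "((\<lambda>y. m t0 *\<^sub>R G t0 y - a *\<^sub>R q y) has_derivative (\<lambda>h. m t0 *\<^sub>R H t0 x0 h - a *\<^sub>R (2 *\<^sub>R h))) (at x0)"
      by (intro has_derivative_diff has_derivative_scaleR_right hess Tt0 True q_der)
    have second_nonpos: "(m t0 *\<^sub>R H t0 x0 b - a *\<^sub>R (2 *\<^sub>R b)) \<bullet> b \<le> 0" for b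
    proof (rule second_derivative_nonpos_at_max[OF _ _ _ second_der])
      show "open U" "x0 \<in> U"
        using op r True by (auto simp: U_def)
      fix y assume "y \<in> U"
      then have y: "y \<in> \<Omega>" "y \<in> closure \<Omega>" "y \<in> cball p R"
        using closure_subset r ball_subset_cball by (auto simp: U_def)
      show "((\<lambda>z. m t0 * v t0 z - a * Q z) has_derivative (\<lambda>h. (m t0 *\<^sub>R G t0 y - a *\<^sub>R q y) \<bullet> h)) (at y)"
        using w_der[OF y(2)] intr[OF y(1)] by simp
      show "m t0 * v t0 y - a * Q y \<le> m t0 * v t0 x0 - a * Q x0"
        using wmax t0 y by blast
    qed
    have "m t0 * (H t0 x0 b \<bullet> b) \<le> 2 * a" if "b \<in> Basis" for b
      using second_nonpos[of b] that by (simp add: inner_diff_left)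
    then have "(\<Sum>b\<in>Basis. m t0 * (H t0 x0 b \<bullet> b)) \<le> (\<Sum>b\<in>(Basis :: (real \<times> 'b) set). 2 * a)"
      by (rule sum_mono)
    then have lap: "m t0 * (\<Sum>b\<in>Basis. H t0 x0 b \<bullet> b) \<le> 2 * a * N"
      by (simp add: sum_distrib_left N_def algebra_simps)
    have "((\<lambda>s. m s * v s x0) has_real_derivative m t0 * (vt t0 x0 - \<kappa> * v t0 x0)) (at t0)"
      using time[OF Tt0 True] unfolding m_def
      by (auto intro!: derivative_eq_intros simp: algebra_simps)
    then have tder: "((\<lambda>s. m s * v s x0) has_derivative (*) (m t0 * (vt t0 x0 - \<kappa> * v t0 x0))) (at t0)"
      by (simp add: has_field_derivative_def)
    \<comment> \<open>Time is only followed backwards, since \<open>t0\<close> may be the final time.\<close>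
    have "(m t0 * (vt t0 x0 - \<kappa> * v t0 x0)) * (- 1) \<le> 0"
    proof (rule directional_derivative_nonpos_at_max[OF tder])
      show "0 < t0 - T"
        using Tt0 by simp
      show "t0 + s *\<^sub>R (- 1) \<in> UNIV \<and> m (t0 + s *\<^sub>R (- 1)) * v (t0 + s *\<^sub>R (- 1)) x0 \<le> m t0 * v t0 x0"
        if "0 < s" "s < t0 - T" for s
        using wmax[of "t0 - s" x0] that t0 x0 by simp
    qed
    then have "\<kappa> * (m t0 * v t0 x0) \<le> m t0 * vt t0 x0"
      by (simp add: algebra_simps)
    moreover have "m t0 * (vt t0 x0 - (\<Sum>b\<in>Basis. H t0 x0 b \<bullet> b)) \<le> m t0 * (L * v t0 x0)"
      using m_pos[of t0] by (intro mult_left_mono ineq Tt0 True v0) auto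
    ultimately have "(\<kappa> - L) * (m t0 * v t0 x0) \<le> 2 * a * N"
      using lap by (simp add: algebra_simps)
    moreover have "1 * (m t0 * v t0 x0) \<le> (\<kappa> - L) * (m t0 * v t0 x0)"
      using W_half M by (intro mult_right_mono) (auto simp: \<kappa>_def)
    ultimately show False
      using a(3) W_half by simp
  next
    case False
    then have fr: "x0 \<in> frontier \<Omega>"
      using x0 clo by blast
    let ?n = "\<nu> x0"
    have n: "outward_unit_normal_at \<Omega> x0 ?n"
      by (rule bspec[OF normal fr])
    have "(- ?n) \<bullet> ?n < 0"
      using outward_normal_nonzero[OF n] by simp
    then obtain d where d: "d > 0" "\<And>s. 0 < s \<Longrightarrow> s < d \<Longrightarrow> x0 + s *\<^sub>R (- ?n) \<in> \<Omega>"
      using outward_normal_enters[OF n] by blast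
    define d' where "d' = min d (r / (norm ?n + 1))"
    have "(m t0 *\<^sub>R G t0 x0 - a *\<^sub>R q x0) \<bullet> (- ?n) \<le> 0"
    proof (rule directional_derivative_nonpos_at_max[OF w_der[OF x0(1)]])
      show "0 < d'"
        using d r by (auto simp: d'_def add_nonneg_pos)
      show "x0 + s *\<^sub>R (- ?n) \<in> closure \<Omega> \<and>
          m t0 * v t0 (x0 + s *\<^sub>R (- ?n)) - a * Q (x0 + s *\<^sub>R (- ?n)) \<le> m t0 * v t0 x0 - a * Q x0"
        if s: "0 < s" "s < d'" for s
      proof -
        have "s * norm ?n \<le> s * (norm ?n + 1)"
          using s by (intro mult_left_mono) auto
        also have "\<dots> < r"
          using s by (simp add: d'_def pos_less_divide_eq add_nonneg_pos)
        finally have "x0 + s *\<^sub>R (- ?n) \<in> ball x0 r"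
          using s by (simp add: dist_norm)
        then have "x0 + s *\<^sub>R (- ?n) \<in> cball p R"
          using r by (meson ball_subset_cball subsetD)
        moreover have "x0 + s *\<^sub>R (- ?n) \<in> closure \<Omega>"
          using d(2)[of s] s closure_subset by (auto simp: d'_def)
        ultimately show ?thesis
          using wmax[of t0] t0 by blast
      qed
    qed
    moreover have "m t0 * (G t0 x0 \<bullet> ?n) \<le> 0"
      using bdry[OF Tt0 fr v0] m_pos[of t0] by (simp add: mult_nonneg_nonpos)
    moreover have "a * (q x0 \<bullet> ?n) > 0"
      using eb[OF fr x0(2) n] a by (simp add: q_def)
    ultimately show False
      by (simp add: inner_diff_left)
  qed
qed

section \<open>The nonlinearity and the profile of the front\<close>

text \<open>The nonlinearity decreases near its two stable zeros, because its derivative is continuous and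
negative there. This is what allows the front to be shifted vertically by a small constant.\<close>

lemma bistable_lipschitz_antimono:
  assumes "bistable_nonlinearity f \<theta>"
  obtains L \<delta> where "0 \<le> L" "0 < \<delta>"
    "\<And>a b. a \<in> {0..1} \<Longrightarrow> b \<in> {0..1} \<Longrightarrow> \<bar>f b - f a\<bar> \<le> L * \<bar>b - a\<bar>"
    "\<And>a b. 0 \<le> a \<Longrightarrow> a \<le> b \<Longrightarrow> b \<le> \<delta> \<Longrightarrow> f b \<le> f a"
    "\<And>a b. 1 - \<delta> \<le> a \<Longrightarrow> a \<le> b \<Longrightarrow> b \<le> 1 \<Longrightarrow> f b \<le> f a"
proof -
  obtain f' K where f': "\<And>s. s \<in> {0..1} \<Longrightarrow> (f has_real_derivative f' s) (at s within {0..1})"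
    and K: "K-lipschitz_on {0..1} f'" and neg: "f' 0 < 0" "f' 1 < 0"
    using assms unfolding bistable_nonlinearity_def by metis
  have K0: "0 \<le> K"
    using K by (rule lipschitz_on_nonneg)
  have Kd: "\<bar>f' x - f' y\<bar> \<le> K * \<bar>x - y\<bar>" if "x \<in> {0..1}" "y \<in> {0..1}" for x y
    using lipschitz_onD[OF K that] by (simp add: dist_real_def)
  define L where "L = \<bar>f' 0\<bar> + K"
  have f'_le: "norm (f' x) \<le> L" if x: "x \<in> {0..1}" for x
  proof -
    have "\<bar>f' x - f' 0\<bar> \<le> K * \<bar>x - 0\<bar>"
      by (rule Kd) (use x in auto)
    also have "\<dots> \<le> K * 1"
      using K0 x by (intro mult_left_mono) auto
    finally show ?thesis
      by (simp add: L_def)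
  qed
  have 1: "\<bar>f b - f a\<bar> \<le> L * \<bar>b - a\<bar>" if "a \<in> {0..1}" "b \<in> {0..1}" for a b
    using field_differentiable_bound[where S = "{0..1::real}", OF _ f' f'_le that(2,1)] by simp
  define \<delta> where "\<delta> = min 1 (min (- f' 0) (- f' 1) / (K + 1))"
  have \<delta>: "0 < \<delta>" "\<delta> \<le> 1"
    using neg K0 by (auto simp: \<delta>_def)
  have "(K + 1) * \<delta> \<le> (K + 1) * (min (- f' 0) (- f' 1) / (K + 1))"
    using K0 by (intro mult_left_mono) (auto simp: \<delta>_def)
  also have "\<dots> = min (- f' 0) (- f' 1)"
    using K0 by simp
  finally have K\<delta>: "K * \<delta> \<le> - f' 0" "K * \<delta> \<le> - f' 1"
    using \<delta> by (auto simp: algebra_simps)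
  have cont: "continuous_on {0..1} f"
    by (rule DERIV_continuous_on[OF f'])
  have decr: "f b \<le> f a"
    if ab: "0 \<le> a" "a \<le> b" "b \<le> 1" and le: "\<And>x. a < x \<Longrightarrow> x < b \<Longrightarrow> f' x \<le> 0" for a b
  proof (rule DERIV_nonpos_imp_decreasing_open[OF ab(2)])
    show "\<exists>y. (f has_real_derivative y) (at x) \<and> y \<le> 0" if x: "a < x" "x < b" for x
    proof -
      have "at x within {0..1} = at x"
        using x ab by (intro at_within_Icc_at) auto
      then show ?thesis
        using f'[of x] le[OF x] x ab by auto
    qed
    show "continuous_on {a..b} f"
      using cont by (rule continuous_on_subset) (use ab in auto)
  qed
  have 2: "f b \<le> f a" if ab: "0 \<le> a" "a \<le> b" "b \<le> \<delta>" for a b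
  proof (rule decr)
    fix x assume x: "a < x" "x < b"
    have "\<bar>f' x - f' 0\<bar> \<le> K * \<bar>x - 0\<bar>"
      by (rule Kd) (use x ab \<delta> in auto)
    also have "\<dots> \<le> K * \<delta>"
      using K0 x ab by (intro mult_left_mono) auto
    finally show "f' x \<le> 0"
      using K\<delta> by simp
  qed (use ab \<delta> in auto)
  have 3: "f b \<le> f a" if ab: "1 - \<delta> \<le> a" "a \<le> b" "b \<le> 1" for a b
  proof (rule decr)
    fix x assume x: "a < x" "x < b"
    have "\<bar>f' x - f' 1\<bar> \<le> K * \<bar>x - 1\<bar>"
      by (rule Kd) (use x ab \<delta> in auto)
    also have "\<dots> \<le> K * \<delta>"
      using K0 x ab by (intro mult_left_mono) auto
    finally show "f' x \<le> 0"
      using K\<delta> by simp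
  qed (use ab \<delta> in auto)
  have "0 \<le> L"
    using K0 by (simp add: L_def)
  then show ?thesis
    using that \<delta>(1) 1 2 3 by blast
qed

text \<open>The energy \<open>E = (\<phi>')\<^sup>2 / 2 + F \<circ> \<phi>\<close>, with \<open>F\<close> the primitive of \<open>f\<close> vanishing at 0, satisfies
\<open>E' = - c * (\<phi>')\<^sup>2 \<le> 0\<close>, and \<open>F \<circ> \<phi>\<close> tends to 0 at infinity, so \<open>E \<ge> 0\<close>. As \<open>F < 0\<close> on \<open>(0, \<theta>]\<close>, a
critical point of \<open>\<phi>\<close> with a value in \<open>(0, 1)\<close> has its value above \<open>\<theta>\<close>, where \<open>\<phi>'' = - f < 0\<close>. Hence
such a critical point is a strict maximum. If \<open>\<phi>\<close> increased anywhere, then, coming from 1 at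
\<open>-\<infinity>\<close>, it would have an interior minimum before; its value could only be 0, the energy would
vanish from then on, and so would \<open>\<phi>'\<close>.\<close>

lemma front_derivative_sign:
  assumes bist: "bistable_nonlinearity f \<theta>" and c: "0 < c"
    and rng: "\<And>z. \<phi> z \<in> {0..1}"
    and d1: "\<And>z. (\<phi> has_real_derivative \<phi>' z) (at z)"
    and d2: "\<And>z. (\<phi>' has_real_derivative \<phi>'' z) (at z)"
    and ode: "\<And>z. \<phi>'' z + c * \<phi>' z + f (\<phi> z) = 0"
    and bot: "(\<phi> \<longlongrightarrow> 1) at_bot" and top: "(\<phi> \<longlongrightarrow> 0) at_top"
  shows "\<phi>' z \<le> 0" and "0 < \<phi> z \<Longrightarrow> \<phi> z < 1 \<Longrightarrow> \<phi>' z < 0"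
proof -
  have \<theta>: "0 < \<theta>" "\<theta> < 1" and fneg: "\<And>s. 0 < s \<Longrightarrow> s < \<theta> \<Longrightarrow> f s < 0"
    and fpos: "\<And>s. \<theta> < s \<Longrightarrow> s < 1 \<Longrightarrow> f s > 0"
    using bist by (auto simp: bistable_nonlinearity_def)
  obtain L where lip: "\<And>a b. a \<in> {0..1} \<Longrightarrow> b \<in> {0..1} \<Longrightarrow> \<bar>f b - f a\<bar> \<le> L * \<bar>b - a\<bar>" and L: "0 \<le> L"
    using bistable_lipschitz_antimono[OF bist] by metis
  have cont: "continuous_on {0..1} f"
    by (rule lipschitz_on_continuous_on[of L], rule lipschitz_onI)
      (use lip L in \<open>auto simp: dist_real_def abs_minus_commute\<close>)
  define F where "F s = integral {0..s} f" for s
  have F_der: "(F has_real_derivative f s) (at s within {0..1})" if "s \<in> {0..1}" for s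
    unfolding F_def using cont that by (rule integral_has_real_derivative)
  have F0: "F 0 = 0"
    by (simp add: F_def)
  have F_cont: "continuous_on {0..1} F"
    by (rule DERIV_continuous_on[OF F_der])
  have F_neg: "F s < 0" if s: "0 < s" "s \<le> \<theta>" for s
  proof -
    have "continuous_on {0..s} F"
      using F_cont by (rule continuous_on_subset) (use s \<theta> in auto)
    moreover have "(F has_real_derivative f x) (at x)" if "0 < x" "x < s" for x
      using F_der[of x] that s \<theta> by (simp add: at_within_Icc_at)
    ultimately obtain x where "0 < x" "x < s" "F s - F 0 = f x * (s - 0)"
      using mvt[OF s(1), of F "\<lambda>x. (*) (f x)"] by (auto simp: has_field_derivative_def)
    then show ?thesis
      using fneg[of x] s F0 by (simp add: mult_neg_pos)
  qed
  define E where "E z = (\<phi>' z)\<^sup>2 / 2 + F (\<phi> z)" for z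
  have E_der: "(E has_real_derivative - c * (\<phi>' z)\<^sup>2) (at z)" for z
  proof -
    have "((\<lambda>z. F (\<phi> z)) has_real_derivative f (\<phi> z) * \<phi>' z) (at z)"
    proof -
      have "range \<phi> \<subseteq> {0..1}"
        using rng by blast
      then have "(F \<circ> \<phi> has_real_derivative f (\<phi> z) * \<phi>' z) (at z)"
        by (intro DERIV_image_chain DERIV_subset[OF F_der[OF rng]] d1)
      then show ?thesis
        by (simp add: o_def)
    qed
    then have "(E has_real_derivative \<phi>' z * \<phi>'' z + f (\<phi> z) * \<phi>' z) (at z)"
      unfolding E_def by (auto intro!: derivative_eq_intros d2 simp: power2_eq_square)
    moreover have "\<phi>'' z = - c * \<phi>' z - f (\<phi> z)"
      using ode[of z] by simp
    ultimately show ?thesis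
      by (simp add: power2_eq_square algebra_simps)
  qed
  have E_anti: "E y \<le> E x" if "x \<le> y" for x y
    using that by (rule DERIV_nonpos_imp_nonincreasing) (use E_der c in \<open>auto intro!: exI\<close>)
  have E_nonneg: "0 \<le> E z" for z
  proof (rule ccontr)
    assume "\<not> 0 \<le> E z"
    then have neg: "E z < 0" by simp
    have "((\<lambda>z. F (\<phi> z)) \<longlongrightarrow> F 0) at_top"
      by (rule continuous_on_tendsto_compose[OF F_cont top]) (use rng in auto)
    then have "eventually (\<lambda>y. E z < F (\<phi> y)) at_top"
      using neg F0 by (auto dest: order_tendstoD)
    moreover have "eventually (\<lambda>y. z \<le> y) at_top"
      by (rule eventually_ge_at_top)
    ultimately have "eventually (\<lambda>y. E z < F (\<phi> y) \<and> z \<le> y) at_top"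
      by eventually_elim auto
    then obtain y where "E z < F (\<phi> y)" "z \<le> y"
      by (auto dest: eventually_happens)
    then show False
      using E_anti[of z y] zero_le_power2[of "\<phi>' y"] unfolding E_def by linarith
  qed
  have crit: "\<phi>'' z < 0" if z: "\<phi>' z = 0" "0 < \<phi> z" "\<phi> z < 1" for z
  proof -
    have "\<theta> < \<phi> z"
      using E_nonneg[of z] F_neg[of "\<phi> z"] z by (force simp: E_def)
    then have "f (\<phi> z) > 0"
      using z by (intro fpos)
    then show ?thesis
      using ode[of z] z by simp
  qed
  have phi_cont: "continuous_on S \<phi>" for S
    using d1 by (auto intro!: continuous_at_imp_continuous_on DERIV_isCont)
  have nonpos: "\<phi>' z1 \<le> 0" for z1
  proof (rule ccontr)
    assume "\<not> \<phi>' z1 \<le> 0"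
    then have pos: "\<phi>' z1 > 0" by simp
    obtain h where h: "h > 0" "\<phi> z1 < \<phi> (z1 + h)"
      using DERIV_pos_inc_right[OF d1 pos] by (metis dense)
    then have "\<phi> z1 < 1"
      using rng[of "z1 + h"] by simp
    then have "eventually (\<lambda>z. \<phi> z1 < \<phi> z \<and> z < z1) at_bot"
      using order_tendstoD(1)[OF bot] eventually_gt_at_bot by (auto intro: eventually_conj)
    then obtain z2 where z2: "\<phi> z1 < \<phi> z2" "z2 < z1"
      by (auto dest: eventually_happens)
    obtain z3 where z3: "z3 \<in> {z2..z1}" "\<And>y. y \<in> {z2..z1} \<Longrightarrow> \<phi> z3 \<le> \<phi> y"
      using continuous_attains_inf[of "{z2..z1}" \<phi>] phi_cont z2 by auto
    obtain d where d: "d > 0" "\<And>h. h > 0 \<Longrightarrow> h < d \<Longrightarrow> \<phi> (z1 - h) < \<phi> z1"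
      using DERIV_pos_inc_left[OF d1 pos] by blast
    define h' where "h' = min d (z1 - z2) / 2"
    have h': "h' > 0" "h' < d" "h' < z1 - z2"
      using d(1) z2 by (auto simp: h'_def min_def)
    have "\<phi> z3 \<le> \<phi> (z1 - h')"
      using h' by (intro z3) auto
    also have "\<dots> < \<phi> z1"
      using h' by (intro d)
    finally have lt: "\<phi> z3 < \<phi> z1" .
    have "z3 \<noteq> z1" "z3 \<noteq> z2"
      using lt z2(1) by auto
    then have z3': "z2 < z3" "z3 < z1"
      using z3(1) by auto
    have crit3: "\<phi>' z3 = 0"
    proof (rule DERIV_local_min[OF d1])
      show "0 < min (z3 - z2) (z1 - z3)"
        using z3' by simp
      show "\<forall>y. \<bar>z3 - y\<bar> < min (z3 - z2) (z1 - z3) \<longrightarrow> \<phi> z3 \<le> \<phi> y"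
        using z3(2) by (auto simp: abs_less_iff)
    qed
    show False
    proof (cases "\<phi> z3 = 0")
      case True
      then have "E z3 = 0"
        by (simp add: E_def crit3 F0)
      then have "E z1 \<le> 0"
        using E_anti[of z3 z1] z3' by simp
      then have "- c * (\<phi>' z1)\<^sup>2 = 0"
        by (intro DERIV_local_min[OF E_der, of 1]) (use E_nonneg order_trans in auto)
      then show False
        using c pos by simp
    next
      case False
      then have "\<phi>'' z3 < 0"
        using crit[OF crit3] rng[of z3] lt \<open>\<phi> z1 < 1\<close> by simp
      then obtain d where d: "d > 0" "\<And>h. h > 0 \<Longrightarrow> h < d \<Longrightarrow> \<phi>' (z3 + h) < \<phi>' z3"
        using DERIV_neg_dec_right[OF d2] by blast
      define h where "h = min d (z1 - z3) / 2"
      have h: "h > 0" "h < d" "h < z1 - z3"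
        using d(1) z3' by (auto simp: h_def min_def)
      obtain y where y: "z3 < y" "y < z3 + h" "\<phi> (z3 + h) - \<phi> z3 = (z3 + h - z3) * \<phi>' y"
        using MVT2[of z3 "z3 + h" \<phi> \<phi>'] d1 h by auto
      then have "\<phi>' y < 0"
        using d(2)[of "y - z3"] h crit3 by simp
      then have "\<phi> (z3 + h) < \<phi> z3"
        using y(3) h mult_pos_neg[of h "\<phi>' y"] by simp
      then show False
        using z3(2)[of "z3 + h"] h z3' by simp
    qed
  qed
  then show "\<phi>' z \<le> 0" .
  assume z: "0 < \<phi> z" "\<phi> z < 1"
  show "\<phi>' z < 0"
  proof (rule ccontr)
    assume "\<not> \<phi>' z < 0"
    then have 0: "\<phi>' z = 0"
      using nonpos[of z] by simp
    then obtain d where "d > 0" "\<And>h. h > 0 \<Longrightarrow> h < d \<Longrightarrow> \<phi>' z < \<phi>' (z - h)"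
      using DERIV_neg_dec_left[OF d2 crit[OF 0 z]] by blast
    then obtain h where "\<phi>' z < \<phi>' (z - h)"
      by (metis dense)
    then show False
      using nonpos[of "z - h"] 0 by simp
  qed
qed

text \<open>The last conclusion is the inequality that makes a vertically shifted front of slightly wrong
speed a sub- or supersolution: \<open>k\<close> is the error in the speed, and \<open>a\<close>, \<open>b\<close> are the value of the front
and its vertical shift. Where \<open>\<phi>\<close> is close to 0 or 1, the left-hand side is nonpositive because \<open>f\<close>
decreases; elsewhere \<open>\<phi>'\<close> is bounded away from 0 by compactness and absorbs the Lipschitz
bound on \<open>f\<close>.\<close>

lemma travelling_front_profile:
  assumes bist: "bistable_nonlinearity f \<theta>" and c: "0 < c" and front: "travelling_front f \<theta> \<phi> c"
  obtains \<phi>' \<phi>'' where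
    "\<And>z. (\<phi> has_real_derivative \<phi>' z) (at z)"
    "\<And>z. (\<phi>' has_real_derivative \<phi>'' z) (at z)"
    "\<And>z. \<phi>'' z + c * \<phi>' z + f (\<phi> z) = 0"
    "\<And>z. \<phi>' z \<le> 0"
    "\<And>k. 0 < k \<Longrightarrow> \<exists>q0>0. \<forall>z a b. 0 \<le> a \<longrightarrow> a \<le> \<phi> z \<longrightarrow> \<phi> z \<le> b \<longrightarrow> b \<le> 1 \<longrightarrow> b - a \<le> q0 \<longrightarrow>
      f b - f a \<le> - (k * \<phi>' z)"
proof -
  have rng: "\<And>z. \<phi> z \<in> {0..1}" and bot: "(\<phi> \<longlongrightarrow> 1) at_bot" and top: "(\<phi> \<longlongrightarrow> 0) at_top"
    using front by (simp_all add: travelling_front_def)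
  obtain \<phi>' \<phi>'' where d1: "\<And>z. (\<phi> has_real_derivative \<phi>' z) (at z)"
    and d2: "\<And>z. (\<phi>' has_real_derivative \<phi>'' z) (at z)"
    and ode: "\<And>z. \<phi>'' z + c * \<phi>' z + f (\<phi> z) = 0"
    using front unfolding travelling_front_def by metis
  note sign = front_derivative_sign[OF bist c rng d1 d2 ode bot top]
  obtain L \<delta> where L: "0 \<le> L" and \<delta>: "0 < \<delta>"
    and lip: "\<And>a b. a \<in> {0..1} \<Longrightarrow> b \<in> {0..1} \<Longrightarrow> \<bar>f b - f a\<bar> \<le> L * \<bar>b - a\<bar>"
    and anti0: "\<And>a b. 0 \<le> a \<Longrightarrow> a \<le> b \<Longrightarrow> b \<le> \<delta> \<Longrightarrow> f b \<le> f a"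
    and anti1: "\<And>a b. 1 - \<delta> \<le> a \<Longrightarrow> a \<le> b \<Longrightarrow> b \<le> 1 \<Longrightarrow> f b \<le> f a"
    using bistable_lipschitz_antimono[OF bist] by blast
  define Z where "Z = {z. \<delta> / 2 \<le> \<phi> z \<and> \<phi> z \<le> 1 - \<delta> / 2}"
  have phi_cont: "continuous_on UNIV \<phi>" and phi'_cont: "continuous_on Z \<phi>'"
    using d1 d2 by (auto intro!: continuous_at_imp_continuous_on DERIV_isCont)
  obtain A where A: "\<And>z. A \<le> z \<Longrightarrow> \<phi> z < \<delta> / 2"
    using order_tendstoD(2)[OF top, of "\<delta> / 2"] \<delta> by (auto simp: eventually_at_top_linorder)
  obtain B where B: "\<And>z. z \<le> B \<Longrightarrow> 1 - \<delta> / 2 < \<phi> z"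
    using order_tendstoD(1)[OF bot, of "1 - \<delta> / 2"] \<delta> by (auto simp: eventually_at_bot_linorder)
  have "Z \<subseteq> {B..A}"
    using A B by (force simp: Z_def not_less[symmetric])
  moreover have "closed Z"
    unfolding Z_def by (intro closed_Collect_conj closed_Collect_le phi_cont continuous_on_const)
  ultimately have "compact Z"
    by (metis compact_Icc compact_Int_closed inf.absorb_iff2)
  have "\<exists>\<kappa>>0. \<forall>z\<in>Z. \<phi>' z \<le> - \<kappa>"
  proof (cases "Z = {}")
    case True
    then show ?thesis
      by (auto intro: exI[of _ 1])
  next
    case False
    obtain y where y: "y \<in> Z" "\<And>z. z \<in> Z \<Longrightarrow> \<phi>' z \<le> \<phi>' y"
      using continuous_attains_sup[OF \<open>compact Z\<close> False phi'_cont] by blast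
    have "\<phi>' y < 0"
      using y(1) \<delta> by (intro sign) (auto simp: Z_def)
    then show ?thesis
      using y(2) by (intro exI[of _ "- \<phi>' y"]) auto
  qed
  then obtain \<kappa> where \<kappa>: "\<kappa> > 0" "\<And>z. z \<in> Z \<Longrightarrow> \<phi>' z \<le> - \<kappa>"
    by blast
  have gap: "\<exists>q0>0. \<forall>z a b. 0 \<le> a \<longrightarrow> a \<le> \<phi> z \<longrightarrow> \<phi> z \<le> b \<longrightarrow> b \<le> 1 \<longrightarrow> b - a \<le> q0 \<longrightarrow>
      f b - f a \<le> - (k * \<phi>' z)" if k: "0 < k" for k
  proof (intro exI conjI allI impI)
    let ?q = "min (\<delta> / 2) (k * \<kappa> / (L + 1))"
    show "0 < ?q"
      using k \<kappa> L \<delta> by simp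
    fix z a b assume ab: "0 \<le> a" "a \<le> \<phi> z" "\<phi> z \<le> b" "b \<le> 1" "b - a \<le> ?q"
    have nonneg: "0 \<le> - (k * \<phi>' z)"
      using k sign(1)[of z] by (simp add: mult_nonneg_nonpos)
    consider "\<phi> z < \<delta> / 2" | "1 - \<delta> / 2 < \<phi> z" | "z \<in> Z"
      by (force simp: Z_def)
    then show "f b - f a \<le> - (k * \<phi>' z)"
    proof cases
      case 1
      then show ?thesis
        using anti0[of a b] ab nonneg by auto
    next
      case 2
      then show ?thesis
        using anti1[of a b] ab nonneg by auto
    next
      case 3
      have "f b - f a \<le> L * (b - a)"
        using lip[of a b] ab by auto
      also have "\<dots> \<le> (L + 1) * (k * \<kappa> / (L + 1))"
        using L ab by (intro mult_mono) auto
      also have "\<dots> = k * \<kappa>"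
        using L by simp
      also have "\<dots> \<le> k * (- \<phi>' z)"
        using \<kappa>(2)[OF 3] k by (intro mult_left_mono) auto
      finally show ?thesis
        by simp
    qed
  qed
  show ?thesis
    using that d1 d2 ode sign(1) gap by blast
qed

section \<open>Comparison of the solution with planar waves\<close>

text \<open>The Laplacian of a function of the first coordinate alone.\<close>

lemma trace_first_coordinate:
  "(\<Sum>b\<in>Basis. (k * fst b) *\<^sub>R (1, 0) \<bullet> (b :: real \<times> 'b::euclidean_space)) = k"
proof -
  have "(\<Sum>b\<in>Basis. (k * fst b) *\<^sub>R (1, 0) \<bullet> (b :: real \<times> 'b)) = k * (\<Sum>b\<in>Basis. fst b * fst (b :: real \<times> 'b))"
    by (simp add: inner_prod_def sum_distrib_left mult.assoc)
  also have "(\<Sum>b\<in>Basis. fst b * fst (b :: real \<times> 'b)) = 1"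
    using euclidean_inner[of "(1, 0) :: real \<times> 'b" "(1, 0)"] by (simp add: inner_prod_def)
  finally show ?thesis
    by simp
qed

text \<open>If \<open>\<Omega>\<close> were contained in \<open>{x. a \<le> fst x}\<close>, the comparison principle would apply to the difference of
the stationary function \<open>exp (- fst x)\<close>, whose normal derivative is nonpositive, and its bound
\<open>exp (- a)\<close> damped by \<open>exp (- t)\<close>. Letting time grow yields \<open>exp (- fst x) \<le> 0\<close>, which is absurd. The
result guarantees that the infimum in the asymptotic speed is taken over a nonempty set.\<close>

lemma outward_normal_fst_nonneg_imp_unbounded_left:
  fixes \<Omega> :: "(real \<times> 'b::euclidean_space) set"
  assumes dom: "uniformly_C2_holder_domain \<alpha> \<Omega>"
    and normal: "\<forall>x\<in>frontier \<Omega>. outward_unit_normal_at \<Omega> x (\<nu> x)"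
    and nonneg: "\<forall>x\<in>frontier \<Omega>. 0 \<le> fst (\<nu> x)"
  obtains x where "x \<in> \<Omega>" "fst x < a"
proof (rule ccontr)
  assume contra: "\<not> thesis"
  have "\<Omega> \<subseteq> {x. a \<le> fst x}"
    using contra that by (force simp: not_less)
  then have cl: "closure \<Omega> \<subseteq> {x. a \<le> fst x}"
    by (intro closure_minimal closed_Collect_le continuous_intros)
  define v where "v t x = exp (- fst x) - exp (- a) * exp (- t)" for t :: real and x :: "real \<times> 'b"
  have main: "v t x \<le> 0" if "0 \<le> t" "x \<in> closure \<Omega>" for t x
  proof (rule neumann_comparison[OF dom normal, where v = v and T = 0 and B = "exp (- a)" and L = 0
        and G = "\<lambda>t x. - exp (- fst x) *\<^sub>R (1, 0)" and vt = "\<lambda>t x. exp (- a) * exp (- t)"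
        and H = "\<lambda>t x h. (exp (- fst x) * fst h) *\<^sub>R (1, 0)", OF _ _ _ _ _ _ _ _ that])
    show "continuous_on ({0..} \<times> closure \<Omega>) (\<lambda>(t, x). v t x)"
      unfolding v_def case_prod_beta' by (intro continuous_intros)
    show "v t x \<le> exp (- a)" if "x \<in> closure \<Omega>" for t x
    proof -
      have "exp (- fst x) \<le> exp (- a)"
        using that cl by auto
      then show ?thesis
        unfolding v_def by (smt (verit) exp_gt_zero mult_pos_pos)
    qed
    show "v 0 x \<le> 0" if "x \<in> closure \<Omega>" for x
      using that cl by (auto simp: v_def)
    show "(v t has_derivative (\<lambda>h. - exp (- fst x) *\<^sub>R (1, 0) \<bullet> h)) (at x within closure \<Omega>)" for t x
      unfolding v_def by (auto intro!: derivative_eq_intros simp: inner_prod_def)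
    show "((\<lambda>s. v s x) has_real_derivative exp (- a) * exp (- t)) (at t)" for t x
      unfolding v_def by (auto intro!: derivative_eq_intros)
    show "((\<lambda>x. - exp (- fst x) *\<^sub>R (1, 0)) has_derivative (\<lambda>h. (exp (- fst x) * fst h) *\<^sub>R (1, 0))) (at x)"
      for x :: "real \<times> 'b"
      by (auto intro!: derivative_eq_intros)
    show "exp (- a) * exp (- t) - (\<Sum>b\<in>Basis. (exp (- fst x) * fst b) *\<^sub>R (1, 0) \<bullet> b) \<le> 0 * v t x"
      if "0 < v t x" for t and x :: "real \<times> 'b"
      using that unfolding trace_first_coordinate by (simp add: v_def)
    show "- exp (- fst x) *\<^sub>R (1, 0) \<bullet> \<nu> x \<le> 0" if "x \<in> frontier \<Omega>" for x
      using bspec[OF nonneg that] by (simp add: inner_prod_def)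
  qed
  obtain x where x: "x \<in> \<Omega>"
    using dom by (auto simp: uniformly_C2_holder_domain_def)
  then have xc: "x \<in> closure \<Omega>"
    using closure_subset by blast
  then have "a \<le> fst x"
    using cl by auto
  then have "exp (- fst x) \<le> exp (- a) * exp (- (fst x - a + 1))"
    using main[of "fst x - a + 1" x] xc by (simp add: v_def)
  then have "exp (- fst x) \<le> exp (- fst x - 1)"
    by (simp add: exp_add[symmetric])
  then show False
    by simp
qed

lemma entire_solution_range_closure:
  assumes sol: "entire_neumann_solution f \<Omega> \<nu> u"
    and range: "\<forall>t. \<forall>x\<in>\<Omega>. 0 < u t x \<and> u t x < 1"
    and x: "x \<in> closure \<Omega>"
  shows "0 \<le> u t x" "u t x \<le> 1"
proof -
  have "continuous_on (UNIV \<times> closure \<Omega>) (\<lambda>(t, x). u t x)"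
    using sol by (simp add: entire_neumann_solution_def)
  then have "continuous_on (closure \<Omega>) (\<lambda>x. (\<lambda>(t, x). u t x) (t, x))"
    by (rule continuous_on_compose2) (auto intro!: continuous_intros)
  then have "u t ` closure \<Omega> \<subseteq> {0..1}"
    using range by (intro image_closure_subset) (auto simp: less_imp_le)
  then show "0 \<le> u t x" "u t x \<le> 1"
    using x by auto
qed

text \<open>Planar waves \<open>\<phi> (x\<^sub>1 - s * t - d)\<close> shifted vertically by \<open>q\<close> as barriers for \<open>u\<close>: from below for
\<open>\<sigma> = 1\<close> and a speed \<open>s < c\<close>, from above for \<open>\<sigma> = - 1\<close> and \<open>s > c\<close>. A speed different from \<open>c\<close>
leaves the term \<open>(c - s) * \<phi>'\<close> in the equation, which pays for the constant shift \<open>q\<close>. The normal derivative of the wave is \<open>\<phi>' * fst \<nu>\<close> with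
\<open>\<phi>' \<le> 0\<close>, hence the sign condition on \<open>\<sigma> * fst \<nu>\<close> at the boundary points where the barrier is violated.\<close>

lemma planar_wave_comparison:
  fixes \<Omega> :: "(real \<times> 'b::euclidean_space) set"
  assumes dom: "uniformly_C2_holder_domain \<alpha> \<Omega>"
    and normal: "\<forall>x\<in>frontier \<Omega>. outward_unit_normal_at \<Omega> x (\<nu> x)"
    and bist: "bistable_nonlinearity f \<theta>"
    and c: "0 < c" and front: "travelling_front f \<theta> \<phi> c"
    and sol: "entire_neumann_solution f \<Omega> \<nu> u"
    and range: "\<forall>t. \<forall>x\<in>\<Omega>. 0 < u t x \<and> u t x < 1"
    and \<sigma>: "\<bar>\<sigma>\<bar> = 1" and speed: "0 < \<sigma> * (c - s)"
  shows "\<exists>q0>0. \<forall>q d T. 0 < q \<longrightarrow> q \<le> q0 \<longrightarrow>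
    (\<forall>x\<in>closure \<Omega>. \<sigma> * (\<phi> (fst x - s * T - d) - u T x) \<le> q) \<longrightarrow>
    (\<forall>t>T. \<forall>x\<in>frontier \<Omega>. q < \<sigma> * (\<phi> (fst x - s * t - d) - u t x) \<longrightarrow> 0 \<le> \<sigma> * fst (\<nu> x)) \<longrightarrow>
    (\<forall>t\<ge>T. \<forall>x\<in>closure \<Omega>. \<sigma> * (\<phi> (fst x - s * t - d) - u t x) \<le> q)"
proof -
  obtain \<phi>' \<phi>'' where d1: "\<And>z. (\<phi> has_real_derivative \<phi>' z) (at z)"
    and d2: "\<And>z. (\<phi>' has_real_derivative \<phi>'' z) (at z)"
    and ode: "\<And>z. \<phi>'' z + c * \<phi>' z + f (\<phi> z) = 0"
    and sign: "\<And>z. \<phi>' z \<le> 0"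
    and gap: "\<And>k. 0 < k \<Longrightarrow> \<exists>q0>0. \<forall>z a b. 0 \<le> a \<longrightarrow> a \<le> \<phi> z \<longrightarrow> \<phi> z \<le> b \<longrightarrow> b \<le> 1 \<longrightarrow> b - a \<le> q0 \<longrightarrow>
      f b - f a \<le> - (k * \<phi>' z)"
    using travelling_front_profile[OF bist c front] by metis
  obtain L where lip: "\<And>a b. a \<in> {0..1} \<Longrightarrow> b \<in> {0..1} \<Longrightarrow> \<bar>f b - f a\<bar> \<le> L * \<bar>b - a\<bar>"
    using bistable_lipschitz_antimono[OF bist] by metis
  have \<phi>01: "0 \<le> \<phi> z" "\<phi> z \<le> 1" for z
    using front by (simp_all add: travelling_front_def)
  obtain q0 where q0: "q0 > 0" and gap': "\<And>z a b. 0 \<le> a \<Longrightarrow> a \<le> \<phi> z \<Longrightarrow> \<phi> z \<le> b \<Longrightarrow> b \<le> 1 \<Longrightarrow> b - a \<le> q0 \<Longrightarrow>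
      f b - f a \<le> - (\<sigma> * (c - s) * \<phi>' z)"
    using gap[OF speed] by metis
  have u_cont: "continuous_on (UNIV \<times> closure \<Omega>) (\<lambda>(t, x). u t x)"
    using sol unfolding entire_neumann_solution_def by (rule conjunct1)
  obtain ut G H where
    "\<forall>t. \<forall>x\<in>closure \<Omega>. (u t has_derivative (\<lambda>h. G t x \<bullet> h)) (at x within closure \<Omega>)"
    "\<forall>t. \<forall>x\<in>\<Omega>. ((\<lambda>s. u s x) has_real_derivative ut t x) (at t)"
    "\<forall>t. \<forall>x\<in>\<Omega>. (G t has_derivative blinfun_apply (H t x)) (at x)"
    "\<forall>t. \<forall>x\<in>\<Omega>. ut t x - (\<Sum>b\<in>Basis. blinfun_apply (H t x) b \<bullet> b) = f (u t x)"
    "\<forall>t. \<forall>x\<in>frontier \<Omega>. G t x \<bullet> \<nu> x = 0"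
    using sol unfolding entire_neumann_solution_def by - (elim conjE exE, rule that; assumption)
  then have u_grad: "\<And>t x. x \<in> closure \<Omega> \<Longrightarrow> (u t has_derivative (\<lambda>h. G t x \<bullet> h)) (at x within closure \<Omega>)"
    and u_time: "\<And>t x. x \<in> \<Omega> \<Longrightarrow> ((\<lambda>s. u s x) has_real_derivative ut t x) (at t)"
    and u_hess: "\<And>t x. x \<in> \<Omega> \<Longrightarrow> (G t has_derivative blinfun_apply (H t x)) (at x)"
    and u_eq: "\<And>t x. x \<in> \<Omega> \<Longrightarrow> ut t x - (\<Sum>b\<in>Basis. blinfun_apply (H t x) b \<bullet> b) = f (u t x)"
    and u_bdry: "\<And>t x. x \<in> frontier \<Omega> \<Longrightarrow> G t x \<bullet> \<nu> x = 0"
    by simp_all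
  have phi_cont: "continuous_on S \<phi>" for S
    using d1 by (auto intro!: continuous_at_imp_continuous_on DERIV_isCont)
  have \<sigma>\<sigma>: "\<sigma> = 1 \<or> \<sigma> = - 1"
    using \<sigma> by linarith
  show ?thesis
  proof (intro exI conjI allI impI ballI)
    show "0 < q0"
      by (rule q0)
  next
    fix q d T t and x :: "real \<times> 'b"
    assume q: "0 < q" "q \<le> q0"
      and init: "\<forall>x\<in>closure \<Omega>. \<sigma> * (\<phi> (fst x - s * T - d) - u T x) \<le> q"
      and bdry: "\<forall>t>T. \<forall>x\<in>frontier \<Omega>. q < \<sigma> * (\<phi> (fst x - s * t - d) - u t x) \<longrightarrow> 0 \<le> \<sigma> * fst (\<nu> x)"
      and tx: "T \<le> t" "x \<in> closure \<Omega>"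
    define \<xi> where "\<xi> t x = fst x - s * t - d" for t and x :: "real \<times> 'b"
    define v where "v t x = \<sigma> * (\<phi> (\<xi> t x) - u t x) - q" for t x
    have "v t x \<le> 0"
    proof (rule neumann_comparison[OF dom normal, where v = v and T = T and B = 1 and L = L
          and G = "\<lambda>t x. \<sigma> *\<^sub>R (\<phi>' (\<xi> t x) *\<^sub>R (1, 0) - G t x)"
          and vt = "\<lambda>t x. \<sigma> * (- s * \<phi>' (\<xi> t x) - ut t x)"
          and H = "\<lambda>t x h. \<sigma> *\<^sub>R ((\<phi>'' (\<xi> t x) * fst h) *\<^sub>R (1, 0) - blinfun_apply (H t x) h)",
          OF _ _ _ _ _ _ _ _ tx])
      have "continuous_on ({T..} \<times> closure \<Omega>) (\<lambda>(t, x). u t x)"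
        by (rule continuous_on_subset[OF u_cont]) auto
      moreover have "continuous_on ({T..} \<times> closure \<Omega>) (\<lambda>z. \<phi> (\<xi> (fst z) (snd z)))"
        by (rule continuous_on_compose2[OF phi_cont[of UNIV]]) (auto simp: \<xi>_def intro!: continuous_intros)
      ultimately show "continuous_on ({T..} \<times> closure \<Omega>) (\<lambda>(t, x). v t x)"
        unfolding v_def case_prod_beta' by (intro continuous_intros)
      show "v t x \<le> 1" if "x \<in> closure \<Omega>" for t x
        using entire_solution_range_closure[OF sol range that, of t] \<phi>01[of "\<xi> t x"] \<sigma>\<sigma> q
        by (auto simp: v_def)
      show "v T x \<le> 0" if "x \<in> closure \<Omega>" for x
        using bspec[OF init that] by (simp add: v_def \<xi>_def)
      show "(v t has_derivative (\<lambda>h. \<sigma> *\<^sub>R (\<phi>' (\<xi> t x) *\<^sub>R (1, 0) - G t x) \<bullet> h)) (at x within closure \<Omega>)"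
        if "x \<in> closure \<Omega>" for t x
      proof -
        have "((\<lambda>x. \<phi> (\<xi> t x)) has_derivative (\<lambda>h. fst h *\<^sub>R \<phi>' (\<xi> t x))) (at x within closure \<Omega>)"
          by (rule has_derivative_compose[of _ _ _ _ \<phi>, where g' = "\<lambda>h. h *\<^sub>R \<phi>' (\<xi> t x)"])
            (use d1[of "\<xi> t x"] in \<open>auto simp: \<xi>_def has_field_derivative_def mult_commute_abs intro!: derivative_eq_intros\<close>)
        then show ?thesis
          unfolding v_def using u_grad[OF that, of t]
          by (auto intro!: derivative_eq_intros simp: inner_prod_def fun_eq_iff algebra_simps)
      qed
      show "((\<lambda>s. v s x) has_real_derivative \<sigma> * (- s * \<phi>' (\<xi> t x) - ut t x)) (at t)"
        if "x \<in> \<Omega>" for t x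
      proof -
        have "((\<lambda>t. \<phi> (\<xi> t x)) has_real_derivative \<phi>' (\<xi> t x) * (- s)) (at t)"
          by (rule DERIV_chain2[OF d1]) (auto simp: \<xi>_def intro!: derivative_eq_intros)
        then show ?thesis
          unfolding v_def using u_time[OF that, of t]
          by (auto intro!: derivative_eq_intros)
      qed
      show "((\<lambda>x. \<sigma> *\<^sub>R (\<phi>' (\<xi> t x) *\<^sub>R (1, 0) - G t x)) has_derivative
          (\<lambda>h. \<sigma> *\<^sub>R ((\<phi>'' (\<xi> t x) * fst h) *\<^sub>R (1, 0) - blinfun_apply (H t x) h))) (at x)"
        if "x \<in> \<Omega>" for t x
      proof -
        have "((\<lambda>x. \<phi>' (\<xi> t x)) has_derivative (\<lambda>h. \<phi>'' (\<xi> t x) * fst h)) (at x)"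
          by (rule has_derivative_compose[of _ _ _ _ \<phi>'])
            (use d2[of "\<xi> t x"] in \<open>auto simp: \<xi>_def has_field_derivative_def intro!: derivative_eq_intros\<close>)
        then show ?thesis
          by (intro has_derivative_scaleR_right has_derivative_diff has_derivative_scaleR_left u_hess that)
      qed
      show "\<sigma> *\<^sub>R (\<phi>' (\<xi> t x) *\<^sub>R (1, 0) - G t x) \<bullet> \<nu> x \<le> 0"
        if "T < t" "x \<in> frontier \<Omega>" "0 < v t x" for t x
      proof -
        have "0 \<le> \<sigma> * fst (\<nu> x)"
          using bdry[rule_format, OF that(1,2)] that(3) by (simp add: v_def \<xi>_def)
        then have "\<phi>' (\<xi> t x) * (\<sigma> * fst (\<nu> x)) \<le> 0"
          using sign by (simp add: mult_nonpos_nonneg)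
        moreover have "(\<phi>' (\<xi> t x) *\<^sub>R (1, 0)) \<bullet> \<nu> x = \<phi>' (\<xi> t x) * fst (\<nu> x)"
          by (simp add: inner_prod_def)
        ultimately show ?thesis
          by (simp add: inner_diff_left u_bdry[OF that(2)] mult.left_commute)
      qed
      show "\<sigma> * (- s * \<phi>' (\<xi> t x) - ut t x) -
          (\<Sum>b\<in>Basis. \<sigma> *\<^sub>R ((\<phi>'' (\<xi> t x) * fst b) *\<^sub>R (1, 0) - blinfun_apply (H t x) b) \<bullet> b) \<le> L * v t x"
        if x: "x \<in> \<Omega>" and v: "0 < v t x" for t x
      proof -
        let ?z = "\<xi> t x"
        have "(\<Sum>b\<in>Basis. \<sigma> *\<^sub>R ((\<phi>'' ?z * fst b) *\<^sub>R (1, 0) - blinfun_apply (H t x) b) \<bullet> b) =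
            \<sigma> * (\<Sum>b\<in>Basis. (\<phi>'' ?z * fst b) *\<^sub>R (1, 0) \<bullet> b - blinfun_apply (H t x) b \<bullet> b)"
          by (simp add: inner_diff_left sum_distrib_left)
        also have "\<dots> = \<sigma> * ((\<Sum>b\<in>Basis. (\<phi>'' ?z * fst b) *\<^sub>R (1, 0) \<bullet> (b :: real \<times> 'b)) - (\<Sum>b\<in>Basis. blinfun_apply (H t x) b \<bullet> b))"
          by (simp only: sum_subtractf)
        also have "(\<Sum>b\<in>Basis. (\<phi>'' ?z * fst b) *\<^sub>R (1, 0) \<bullet> (b :: real \<times> 'b)) = \<phi>'' ?z"
          by (rule trace_first_coordinate)
        also have "(\<Sum>b\<in>Basis. blinfun_apply (H t x) b \<bullet> b) = ut t x - f (u t x)"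
          using u_eq[OF x, of t] by simp
        finally have trace: "(\<Sum>b\<in>Basis. \<sigma> *\<^sub>R ((\<phi>'' ?z * fst b) *\<^sub>R (1, 0) - blinfun_apply (H t x) b) \<bullet> b) =
            \<sigma> * (\<phi>'' ?z - (ut t x - f (u t x)))" .
        have ode': "\<phi>'' ?z = - c * \<phi>' ?z - f (\<phi> ?z)"
          using ode[of ?z] by simp
        have eq: "\<sigma> * (- s * \<phi>' ?z - ut t x) -
            (\<Sum>b\<in>Basis. \<sigma> *\<^sub>R ((\<phi>'' ?z * fst b) *\<^sub>R (1, 0) - blinfun_apply (H t x) b) \<bullet> b) =
            \<sigma> * (c - s) * \<phi>' ?z + \<sigma> * (f (\<phi> ?z) - f (u t x))"
          unfolding trace unfolding ode' by (simp add: algebra_simps)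
        have u01: "0 < u t x" "u t x < 1"
          using range x by auto
        from \<sigma>\<sigma> show ?thesis
        proof
          assume 1: "\<sigma> = 1"
          have lt: "u t x < \<phi> ?z - q"
            using v by (simp add: v_def 1)
          have "f (\<phi> ?z) - f (\<phi> ?z - q) \<le> - (\<sigma> * (c - s) * \<phi>' ?z)"
            by (rule gap') (use q lt u01 \<phi>01[of ?z] in auto)
          moreover have "\<bar>f (\<phi> ?z - q) - f (u t x)\<bar> \<le> L * \<bar>\<phi> ?z - q - u t x\<bar>"
            by (rule lip) (use q lt u01 \<phi>01[of ?z] in auto)
          ultimately show ?thesis
            unfolding eq using lt by (simp add: 1 v_def algebra_simps)
        next
          assume 1: "\<sigma> = - 1"
          have lt: "\<phi> ?z + q < u t x"
            using v by (simp add: v_def 1)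
          have "f (\<phi> ?z + q) - f (\<phi> ?z) \<le> - (\<sigma> * (c - s) * \<phi>' ?z)"
            by (rule gap') (use q lt u01 \<phi>01[of ?z] in auto)
          moreover have "\<bar>f (u t x) - f (\<phi> ?z + q)\<bar> \<le> L * \<bar>u t x - (\<phi> ?z + q)\<bar>"
            by (rule lip) (use q lt u01 \<phi>01[of ?z] in auto)
          ultimately show ?thesis
            unfolding eq using lt by (simp add: 1 v_def algebra_simps)
        qed
      qed
    qed
    then show "\<sigma> * (\<phi> (fst x - s * t - d) - u t x) \<le> q"
      by (simp add: v_def \<xi>_def)
  qed
qed

section \<open>Invasion and the speed of propagation\<close>

lemma travelling_front_antimono:
  assumes "bistable_nonlinearity f \<theta>" "0 < c" "travelling_front f \<theta> \<phi> c" "x \<le> y"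
  shows "\<phi> y \<le> \<phi> x"
proof -
  obtain \<phi>' where d1: "\<And>z. (\<phi> has_real_derivative \<phi>' z) (at z)" and sign: "\<And>z. \<phi>' z \<le> 0"
    using travelling_front_profile[OF assms(1-3)] by metis
  show ?thesis
    using assms(4) by (rule DERIV_nonpos_imp_nonincreasing) (use d1 sign in blast)
qed

text \<open>In the distant past \<open>u\<close> is uniformly close to the front, so a planar wave of speed \<open>s\<close> between
\<open>c'\<close> and \<open>c\<close>, lowered by \<open>q\<close>, lies below \<open>u\<close>. It remains below because its normal derivative has the
favourable sign, and behind \<open>c' * t\<close> it tends to \<open>1 - q\<close>.\<close>

lemma invasion_from_left:
  fixes \<Omega> :: "(real \<times> 'b::euclidean_space) set"
  assumes dom: "uniformly_C2_holder_domain \<alpha> \<Omega>"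
    and normal: "\<forall>x\<in>frontier \<Omega>. outward_unit_normal_at \<Omega> x (\<nu> x)"
    and bist: "bistable_nonlinearity f \<theta>"
    and c: "0 < c" and front: "travelling_front f \<theta> \<phi> c"
    and sol: "entire_neumann_solution f \<Omega> \<nu> u"
    and range: "\<forall>t. \<forall>x\<in>\<Omega>. 0 < u t x \<and> u t x < 1"
    and past: "uniform_limit (closure \<Omega>) (\<lambda>t x. u t x - \<phi> (fst x - c * t)) (\<lambda>_. 0) at_bot"
    and nonneg: "\<forall>x\<in>frontier \<Omega>. 0 \<le> fst (\<nu> x)"
    and c': "c' < c" and \<epsilon>: "0 < \<epsilon>"
  shows "eventually (\<lambda>t. \<forall>x\<in>\<Omega>. fst x < c' * t \<longrightarrow> 1 - \<epsilon> < u t x) at_top"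
proof -
  define s where "s = (c' + c) / 2"
  have s: "c' < s" "s < c"
    using c' by (auto simp: s_def)
  have speed: "0 < 1 * (c - s)" "\<bar>1 :: real\<bar> = 1"
    using s by auto
  obtain q0 where q0: "q0 > 0" and comparison:
    "\<forall>q d T. 0 < q \<longrightarrow> q \<le> q0 \<longrightarrow>
      (\<forall>x\<in>closure \<Omega>. 1 * (\<phi> (fst x - s * T - d) - u T x) \<le> q) \<longrightarrow>
      (\<forall>t>T. \<forall>x\<in>frontier \<Omega>. q < 1 * (\<phi> (fst x - s * t - d) - u t x) \<longrightarrow> 0 \<le> 1 * fst (\<nu> x)) \<longrightarrow>
      (\<forall>t\<ge>T. \<forall>x\<in>closure \<Omega>. 1 * (\<phi> (fst x - s * t - d) - u t x) \<le> q)"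
    using planar_wave_comparison[OF dom normal bist c front sol range speed(2,1)] by - (elim exE conjE, rule that)
  define q where "q = min q0 (\<epsilon> / 2)"
  have q: "0 < q" "q \<le> q0" "q \<le> \<epsilon> / 2"
    using q0 \<epsilon> by (auto simp: q_def)
  have "eventually (\<lambda>t. \<forall>x\<in>closure \<Omega>. dist (u t x - \<phi> (fst x - c * t)) 0 < q) at_bot"
    using uniform_limitD[OF past q(1)] .
  then obtain T where T: "\<And>x. x \<in> closure \<Omega> \<Longrightarrow> \<bar>u T x - \<phi> (fst x - c * T)\<bar> < q"
    by (auto dest!: eventually_happens simp: dist_real_def)
  \<comment> \<open>This phase makes the slower wave coincide with the front at time \<open>T\<close>.\<close>
  define d where "d = c * T - s * T"
  have below: "\<phi> (fst x - s * t - d) - q \<le> u t x" if "T \<le> t" "x \<in> closure \<Omega>" for t x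
  proof -
    have "1 * (\<phi> (fst x - s * t - d) - u t x) \<le> q"
    proof (rule comparison[rule_format, OF q(1,2) _ _ that])
      fix x assume "x \<in> closure \<Omega>"
      from T[OF this] show "1 * (\<phi> (fst x - s * T - d) - u T x) \<le> q"
        by (simp add: d_def)
    qed (simp add: nonneg)
    then show ?thesis
      by simp
  qed
  have "filterlim (\<lambda>t. - d + (c' - s) * t) at_bot at_top"
  proof -
    have "filterlim (\<lambda>t. d + (s - c') * t) at_top at_top"
      using s by (intro filterlim_tendsto_add_at_top[OF tendsto_const]
          filterlim_tendsto_pos_mult_at_top[OF tendsto_const] filterlim_ident) auto
    then show ?thesis
      unfolding filterlim_uminus_at_bot by (simp add: algebra_simps)
  qed
  then have "((\<lambda>t. \<phi> (- d + (c' - s) * t)) \<longlongrightarrow> 1) at_top"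
    by (rule filterlim_compose[rotated]) (use front in \<open>simp add: travelling_front_def\<close>)
  then have "eventually (\<lambda>t. 1 - \<epsilon> / 2 < \<phi> (- d + (c' - s) * t)) at_top"
    by (rule order_tendstoD) (use \<epsilon> in simp)
  moreover have "eventually (\<lambda>t. T \<le> t) at_top"
    by (rule eventually_ge_at_top)
  ultimately show ?thesis
  proof eventually_elim
    case (elim t)
    show ?case
    proof (intro ballI impI)
      fix x assume x: "x \<in> \<Omega>" "fst x < c' * t"
      have "\<phi> (- d + (c' - s) * t) \<le> \<phi> (fst x - s * t - d)"
        by (rule travelling_front_antimono[OF bist c front]) (use x in \<open>simp add: algebra_simps\<close>)
      moreover have "\<phi> (fst x - s * t - d) - q \<le> u t x"
        using elim x closure_subset by (intro below) auto
      ultimately show "1 - \<epsilon> < u t x"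
        using elim q by simp
    qed
  qed
qed

text \<open>A planar wave of speed \<open>s\<close> between \<open>c\<close> and \<open>c'\<close>, raised by \<open>q\<close>, is kept above 1 on \<open>fst x \<le> l\<close> for
all times by a suitable phase, so it can fail to dominate \<open>u\<close> only inside the straight cylinder,
where the normal has no first component and the wave satisfies the Neumann condition. At a time
far in the past, \<open>u \<le> q\<close> holds there. Ahead of \<open>c' * t\<close> the wave tends to \<open>q\<close>.\<close>

lemma vanishing_ahead_of_front:
  fixes \<Omega> :: "(real \<times> 'b::euclidean_space) set"
  assumes dom: "uniformly_C2_holder_domain \<alpha> \<Omega>"
    and normal: "\<forall>x\<in>frontier \<Omega>. outward_unit_normal_at \<Omega> x (\<nu> x)"
    and bist: "bistable_nonlinearity f \<theta>"
    and c: "0 < c" and front: "travelling_front f \<theta> \<phi> c"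
    and sol: "entire_neumann_solution f \<Omega> \<nu> u"
    and range: "\<forall>t. \<forall>x\<in>\<Omega>. 0 < u t x \<and> u t x < 1"
    and past: "uniform_limit (closure \<Omega>) (\<lambda>t x. u t x - \<phi> (fst x - c * t)) (\<lambda>_. 0) at_bot"
    and right: "\<Omega> \<inter> {x. fst x > l} = {l<..} \<times> \<omega>"
    and c': "c < c'" and \<epsilon>: "0 < \<epsilon>"
  shows "eventually (\<lambda>t. \<forall>x\<in>\<Omega>. c' * t < fst x \<longrightarrow> u t x < \<epsilon>) at_top"
proof -
  have op: "open \<Omega>"
    using dom by (simp add: uniformly_C2_holder_domain_def)
  have bot: "(\<phi> \<longlongrightarrow> 1) at_bot" and top: "(\<phi> \<longlongrightarrow> 0) at_top" and \<phi>0: "\<And>z. 0 \<le> \<phi> z"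
    using front by (simp_all add: travelling_front_def)
  define s where "s = (c' + c) / 2"
  have s: "s < c'" "c < s" "0 < s"
    using c' c by (auto simp: s_def)
  have speed: "0 < - 1 * (c - s)" "\<bar>- 1 :: real\<bar> = 1"
    using s by auto
  obtain q0 where q0: "q0 > 0" and comparison:
    "\<forall>q d T. 0 < q \<longrightarrow> q \<le> q0 \<longrightarrow>
      (\<forall>x\<in>closure \<Omega>. - 1 * (\<phi> (fst x - s * T - d) - u T x) \<le> q) \<longrightarrow>
      (\<forall>t>T. \<forall>x\<in>frontier \<Omega>. q < - 1 * (\<phi> (fst x - s * t - d) - u t x) \<longrightarrow> 0 \<le> - 1 * fst (\<nu> x)) \<longrightarrow>
      (\<forall>t\<ge>T. \<forall>x\<in>closure \<Omega>. - 1 * (\<phi> (fst x - s * t - d) - u t x) \<le> q)"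
    using planar_wave_comparison[OF dom normal bist c front sol range speed(2,1)] by - (elim exE conjE, rule that)
  have \<nu>_right: "fst (\<nu> x) \<le> 0" if x: "x \<in> frontier \<Omega>" "l < fst x" for x
  proof (rule ccontr)
    assume "\<not> fst (\<nu> x) \<le> 0"
    \<comment> \<open>Moving left from \<open>x\<close> would enter the cylinder, but \<open>x\<close> is on the same horizontal line.\<close>
    then have "(- 1, 0) \<bullet> \<nu> x < 0"
      by (simp add: inner_prod_def)
    then obtain e where e: "e > 0" "\<And>r. 0 < r \<Longrightarrow> r < e \<Longrightarrow> x + r *\<^sub>R (- 1, 0) \<in> \<Omega>"
      using outward_normal_enters[OF bspec[OF normal x(1)]] by blast
    define r where "r = min e (fst x - l) / 2"
    have r: "0 < r" "r < e" "r < fst x - l"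
      using e(1) x(2) by (auto simp: r_def min_def)
    have "x + r *\<^sub>R (- 1, 0) \<in> \<Omega> \<inter> {x. fst x > l}"
      using e(2)[OF r(1,2)] r by auto
    then have "snd x \<in> \<omega>"
      unfolding right by (simp add: mem_Times_iff)
    then have "x \<in> {l<..} \<times> \<omega>"
      using x by (simp add: mem_Times_iff)
    then have "x \<in> \<Omega>"
      using right by blast
    then show False
      using x op by (simp add: frontier_def interior_open)
  qed
  define q where "q = min q0 (\<epsilon> / 2)"
  have q: "0 < q" "q \<le> q0" "q \<le> \<epsilon> / 2"
    using q0 \<epsilon> by (auto simp: q_def)
  have u1: "u t x \<le> 1" if "x \<in> closure \<Omega>" for t x
    by (rule entire_solution_range_closure[OF sol range that])
  have "eventually (\<lambda>t. \<forall>x\<in>closure \<Omega>. dist (u t x - \<phi> (fst x - c * t)) 0 < q / 2) at_bot"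
    using uniform_limitD[OF past, of "q / 2"] q by simp
  moreover have "eventually (\<lambda>t. \<phi> (l - c * t) < q / 2) at_bot"
  proof -
    have "filterlim (\<lambda>t. l + c * (- t)) at_top at_bot"
      using c by (intro filterlim_tendsto_add_at_top[OF tendsto_const]
          filterlim_tendsto_pos_mult_at_top[OF tendsto_const] filterlim_uminus_at_top_at_bot) auto
    then have "((\<lambda>t. \<phi> (l + c * (- t))) \<longlongrightarrow> 0) at_bot"
      by (rule filterlim_compose[OF top])
    then show ?thesis
      using order_tendstoD(2)[of _ 0 at_bot "q / 2"] q by simp
  qed
  ultimately have "eventually (\<lambda>t. (\<forall>x\<in>closure \<Omega>. dist (u t x - \<phi> (fst x - c * t)) 0 < q / 2) \<and>
      \<phi> (l - c * t) < q / 2) at_bot"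
    by eventually_elim auto
  then obtain T where T: "\<And>x. x \<in> closure \<Omega> \<Longrightarrow> \<bar>u T x - \<phi> (fst x - c * T)\<bar> < q / 2"
    and Tl: "\<phi> (l - c * T) < q / 2"
    by (auto dest!: eventually_happens simp: dist_real_def)
  have "eventually (\<lambda>z. 1 - q < \<phi> z) at_bot"
    using order_tendstoD(1)[OF bot, of "1 - q"] q by simp
  then obtain A where A: "\<And>z. z \<le> A \<Longrightarrow> 1 - q < \<phi> z"
    by (auto simp: eventually_at_bot_linorder)
  \<comment> \<open>At time \<open>T\<close> the argument of the wave at \<open>fst x = l\<close> is \<open>A\<close>.\<close>
  define d where "d = l - s * T - A"
  have left: "- 1 * (\<phi> (fst x - s * t - d) - u t x) \<le> q"
    if "T \<le> t" "x \<in> closure \<Omega>" "fst x \<le> l" for t x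
  proof -
    have "s * T \<le> s * t"
      using that s by simp
    then have "1 - q < \<phi> (fst x - s * t - d)"
      using that by (intro A) (simp add: d_def)
    then show ?thesis
      using u1[OF that(2), of t] by simp
  qed
  have above: "u t x \<le> \<phi> (fst x - s * t - d) + q" if tx: "T \<le> t" "x \<in> closure \<Omega>" for t x
  proof -
    have "- 1 * (\<phi> (fst x - s * t - d) - u t x) \<le> q"
    proof (rule comparison[rule_format, OF q(1,2) _ _ tx])
      fix x assume x: "x \<in> closure \<Omega>"
      show "- 1 * (\<phi> (fst x - s * T - d) - u T x) \<le> q"
      proof (cases "fst x \<le> l")
        case True
        then show ?thesis
          using left[of T x] x by simp
      next
        case False
        then have "\<phi> (fst x - c * T) \<le> \<phi> (l - c * T)"
          by (intro travelling_front_antimono[OF bist c front]) simp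
        moreover have "u T x < \<phi> (fst x - c * T) + q / 2"
          using T[OF x] unfolding abs_less_iff by linarith
        ultimately have "u T x \<le> q + \<phi> (fst x - s * T - d)"
          using Tl \<phi>0[of "fst x - s * T - d"] by linarith
        then show ?thesis
          by simp
      qed
    next
      fix t x assume t: "T < t" and x: "x \<in> frontier \<Omega>"
        and gt: "q < - 1 * (\<phi> (fst x - s * t - d) - u t x)"
      have "x \<in> closure \<Omega>"
        using x by (simp add: frontier_def)
      then have "l < fst x"
        using left[of t x] t gt by (cases "fst x \<le> l") auto
      then show "0 \<le> - 1 * fst (\<nu> x)"
        using \<nu>_right[OF x] by simp
    qed
    then show ?thesis
      by simp
  qed
  have "filterlim (\<lambda>t. - d + (c' - s) * t) at_top at_top"
    using s by (intro filterlim_tendsto_add_at_top[OF tendsto_const]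
        filterlim_tendsto_pos_mult_at_top[OF tendsto_const] filterlim_ident) auto
  then have "((\<lambda>t. \<phi> (- d + (c' - s) * t)) \<longlongrightarrow> 0) at_top"
    by (rule filterlim_compose[OF top])
  then have "eventually (\<lambda>t. \<phi> (- d + (c' - s) * t) < \<epsilon> / 2) at_top"
    by (rule order_tendstoD) (use \<epsilon> in simp)
  moreover have "eventually (\<lambda>t. T \<le> t) at_top"
    by (rule eventually_ge_at_top)
  ultimately show ?thesis
  proof eventually_elim
    case (elim t)
    show ?case
    proof (intro ballI impI)
      fix x assume x: "x \<in> \<Omega>" "c' * t < fst x"
      have "\<phi> (fst x - s * t - d) \<le> \<phi> (- d + (c' - s) * t)"
        by (rule travelling_front_antimono[OF bist c front]) (use x in \<open>simp add: algebra_simps\<close>)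
      moreover have "u t x \<le> \<phi> (fst x - s * t - d) + q"
        using elim x closure_subset by (intro above) auto
      ultimately show "u t x < \<epsilon>"
        using elim q by simp
    qed
  qed
qed

text \<open>The suprema and infima in the speed of propagation are taken over sets depending on time and in the
complete lattice \<^typ>\<open>ennreal\<close>, where the supremum of the empty set is 0 but its infimum is
infinite; hence the witness demanded in the second lemma.\<close>

lemma tendsto_SUP_ennreal_0:
  fixes h :: "'i \<Rightarrow> 'a \<Rightarrow> real"
  assumes "\<And>\<epsilon>. 0 < \<epsilon> \<Longrightarrow> eventually (\<lambda>t. \<forall>x\<in>A t. h t x < \<epsilon>) F"
  shows "((\<lambda>t. SUP x\<in>A t. ennreal (h t x)) \<longlongrightarrow> 0) F"
proof (rule order_tendstoI)
  fix a :: ennreal assume "0 < a"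
  then obtain b where b: "0 < b" "b < a"
    using dense by blast
  then have "b \<noteq> top"
    by auto
  then obtain r where r: "b = ennreal r" "0 \<le> r"
    by (cases b) auto
  then have "0 < r"
    using b by (simp add: ennreal_less_zero_iff)
  from assms[OF this] show "eventually (\<lambda>t. (SUP x\<in>A t. ennreal (h t x)) < a) F"
  proof eventually_elim
    case (elim t)
    have "(SUP x\<in>A t. ennreal (h t x)) \<le> b"
      using elim by (intro SUP_least) (auto simp: r less_imp_le intro!: ennreal_leI)
    then show ?case
      using b(2) by (rule le_less_trans)
  qed
qed simp

lemma tendsto_INF_ennreal_1:
  fixes h :: "'i \<Rightarrow> 'a \<Rightarrow> real"
  assumes lower: "\<And>\<epsilon>. 0 < \<epsilon> \<Longrightarrow> eventually (\<lambda>t. \<forall>x\<in>A t. 1 - \<epsilon> < h t x) F"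
    and upper: "\<And>t. \<exists>x\<in>A t. h t x \<le> 1"
  shows "((\<lambda>t. INF x\<in>A t. ennreal (h t x)) \<longlongrightarrow> 1) F"
proof (rule order_tendstoI)
  fix a :: ennreal assume "a < 1"
  then obtain b where b: "a < b" "b < 1"
    using dense by blast
  then have "b \<noteq> top"
    by auto
  then obtain r where r: "b = ennreal r" "0 \<le> r"
    by (cases b) auto
  then have "r < 1"
    using b by (simp add: ennreal_less_one_iff)
  then have "0 < 1 - r"
    by simp
  from lower[OF this] show "eventually (\<lambda>t. a < (INF x\<in>A t. ennreal (h t x))) F"
  proof eventually_elim
    case (elim t)
    have "b \<le> (INF x\<in>A t. ennreal (h t x))"
      using elim by (intro INF_greatest) (auto simp: r less_imp_le intro!: ennreal_leI)
    with b(1) show ?case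
      by (rule less_le_trans)
  qed
next
  fix a :: ennreal assume a: "1 < a"
  have "(INF x\<in>A t. ennreal (h t x)) < a" for t
  proof -
    obtain x where "x \<in> A t" "h t x \<le> 1"
      using upper by blast
    then have "(INF x\<in>A t. ennreal (h t x)) \<le> 1"
      by (intro INF_lower2) auto
    then show ?thesis
      using a by (rule le_less_trans)
  qed
  then show "eventually (\<lambda>t. (INF x\<in>A t. ennreal (h t x)) < a) F"
    by simp
qed

theorem theorem1p6:
  fixes \<Omega> :: "(real \<times> (real ^ 'n)) set"
    and \<omega> :: "(real ^ 'n) set"
    and \<nu> :: "real \<times> (real ^ 'n) \<Rightarrow> real \<times> (real ^ 'n)"
    and f \<phi> :: "real \<Rightarrow> real"
    and \<alpha> \<theta> c :: real
    and u :: "real \<Rightarrow> real \<times> (real ^ 'n) \<Rightarrow> real"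
  assumes alpha: "0 < \<alpha>" "\<alpha> < 1"
    and domain: "uniformly_C2_holder_domain \<alpha> \<Omega>" "\<not> bounded \<Omega>"
    and left_cylinder: "open \<omega>" "\<Omega> \<inter> {x. fst x < 0} = {..<0} \<times> \<omega>"
    and normal: "\<forall>x\<in>frontier \<Omega>. outward_unit_normal_at \<Omega> x (\<nu> x)"
    and nonlinearity: "bistable_nonlinearity f \<theta>"
    and front: "0 < c" "travelling_front f \<theta> \<phi> c"
    and solution: "entire_neumann_solution f \<Omega> \<nu> u"
    and range: "\<forall>t. \<forall>x\<in>\<Omega>. 0 < u t x \<and> u t x < 1"
    and past: "uniform_limit (closure \<Omega>) (\<lambda>t x. u t x - \<phi> (fst x - c * t)) (\<lambda>_. 0) at_bot"
    and nu1_nonneg: "\<forall>x\<in>frontier \<Omega>. 0 \<le> fst (\<nu> x)"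
  shows "(\<forall>K. compact K \<and> K \<subseteq> \<Omega> \<longrightarrow> uniform_limit K u (\<lambda>_. 1) at_top) \<and>
    (\<forall>u_inf. C2_loc_tendsto \<Omega> u u_inf at_top \<longrightarrow> (\<forall>x\<in>\<Omega>. u_inf x = 1)) \<and>
    ((\<exists>l>0. \<exists>\<omega>\<^sub>r. \<Omega> \<inter> {x. fst x > l} = {l<..} \<times> \<omega>\<^sub>r) \<longrightarrow>
      (\<forall>c'>c. ((\<lambda>t. SUP x\<in>{x \<in> \<Omega>. fst x > c' * t}. ennreal (u t x)) \<longlongrightarrow> 0) at_top) \<and>
      (\<forall>c'<c. ((\<lambda>t. INF x\<in>{x \<in> \<Omega>. fst x < c' * t}. ennreal (u t x)) \<longlongrightarrow> 1) at_top))"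
proof -
  have inv: "eventually (\<lambda>t. \<forall>x\<in>\<Omega>. fst x < c' * t \<longrightarrow> 1 - \<epsilon> < u t x) at_top"
    if "c' < c" "0 < \<epsilon>" for c' \<epsilon>
    by (rule invasion_from_left[OF domain(1) normal nonlinearity front solution range past nu1_nonneg that])
  have local: "uniform_limit K u (\<lambda>_. 1) at_top" if K: "compact K" "K \<subseteq> \<Omega>" for K
  proof (rule uniform_limitI)
    fix \<epsilon> :: real assume \<epsilon>: "0 < \<epsilon>"
    have "bounded (fst ` K)"
      using K(1) by (intro compact_imp_bounded compact_continuous_image continuous_intros)
    then obtain b where b: "\<And>x. x \<in> K \<Longrightarrow> \<bar>fst x\<bar> \<le> b"
      by (auto simp: bounded_iff)
    have "eventually (\<lambda>t. \<forall>x\<in>\<Omega>. fst x < c / 2 * t \<longrightarrow> 1 - \<epsilon> < u t x) at_top"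
      using front(1) \<epsilon> by (intro inv) auto
    moreover have "eventually (\<lambda>t. 2 * b / c < t) at_top"
      by (rule eventually_gt_at_top)
    ultimately show "eventually (\<lambda>t. \<forall>x\<in>K. dist (u t x) 1 < \<epsilon>) at_top"
    proof eventually_elim
      case (elim t)
      show ?case
      proof
        fix x assume x: "x \<in> K"
        have "b < c / 2 * t"
          using elim(2) front(1) by (simp add: field_simps)
        then have "fst x < c / 2 * t"
          using b[OF x] by simp
        then have "1 - \<epsilon> < u t x" "u t x < 1"
          using elim(1) x K(2) range by blast+
        then show "dist (u t x) 1 < \<epsilon>"
          by (simp add: dist_real_def)
      qed
    qed
  qed
  have limit: "u_inf x = 1" if "C2_loc_tendsto \<Omega> u u_inf at_top" "x \<in> \<Omega>" for u_inf x
  proof -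
    have K: "compact {x}" "{x} \<subseteq> \<Omega>"
      using that(2) by auto
    have "uniform_limit {x} u u_inf at_top"
      using that(1) K unfolding C2_loc_tendsto_def by blast
    then have "((\<lambda>t. u t x) \<longlongrightarrow> u_inf x) at_top"
      by (rule tendsto_uniform_limitI) simp
    moreover have "((\<lambda>t. u t x) \<longlongrightarrow> 1) at_top"
      by (rule tendsto_uniform_limitI[OF local[OF K]]) simp
    ultimately show ?thesis
      by (rule tendsto_unique[rotated]) simp
  qed
  have ahead: "((\<lambda>t. SUP x\<in>{x \<in> \<Omega>. fst x > c' * t}. ennreal (u t x)) \<longlongrightarrow> 0) at_top"
    if right: "\<Omega> \<inter> {x. fst x > l} = {l<..} \<times> \<omega>\<^sub>r" and c': "c < c'" for l \<omega>\<^sub>r c'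
  proof (rule tendsto_SUP_ennreal_0)
    show "eventually (\<lambda>t. \<forall>x\<in>{x \<in> \<Omega>. fst x > c' * t}. u t x < \<epsilon>) at_top" if "0 < \<epsilon>" for \<epsilon>
      using vanishing_ahead_of_front[OF domain(1) normal nonlinearity front solution range past right c' that]
      by (rule eventually_mono) blast
  qed
  have behind: "((\<lambda>t. INF x\<in>{x \<in> \<Omega>. fst x < c' * t}. ennreal (u t x)) \<longlongrightarrow> 1) at_top"
    if c': "c' < c" for c'
  proof (rule tendsto_INF_ennreal_1)
    show "eventually (\<lambda>t. \<forall>x\<in>{x \<in> \<Omega>. fst x < c' * t}. 1 - \<epsilon> < u t x) at_top" if "0 < \<epsilon>" for \<epsilon>
      using inv[OF c' that] by (rule eventually_mono) blast
    show "\<exists>x\<in>{x \<in> \<Omega>. fst x < c' * t}. u t x \<le> 1" for t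
    proof -
      obtain x where "x \<in> \<Omega>" "fst x < c' * t"
        using outward_normal_fst_nonneg_imp_unbounded_left[OF domain(1) normal nu1_nonneg] by blast
      then show ?thesis
        using range less_imp_le by blast
    qed
  qed
  show ?thesis
    using local limit ahead behind by blast
qed

end
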